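(* Let $X$ be a complex Banach space and let $A\subseteq B(X)$ be an abelian, unital, strongly closed subalgebra with split strict multiplicity $s.s.m.(A)=p\in\mathbb{N}$, realized by vectors $x_1,\dots,x_p\in X$. For $j=1,\dots,p$ let $I_j=\{a\in A : ax_j=0\}$, let $\varphi_j:A\to A/I_j$ be the quotient map, let $\mathcal{R}_j$ be the radical of $A/I_j$, and let $S:\bigoplus_{j=1}^p A/I_j\to X$ be the Banach space isomorphism $S(\varphi_1(a_1)\oplus\cdots\oplus\varphi_p(a_p))=\sum_{j=1}^p a_jx_j$. Then for every $T\in algLat(A)$ there is $a_0\in A$ such that $$(T-a_0)x\in S\Big(\bigoplus_{j=1}^p\mathcal{R}_j\Big)\quad\text{for every }x\in X.$$
   Context: $B(X)$ is the algebra of bounded linear operators on $X$; "strongly closed" means closed in the strong operator topology; $A$ carries the operator norm. $Lat(A)$ is the set of closed subspaces of $X$ invariant under every $a\in A$, and $algLat(A)=\{T\in B(X) : TK\subseteq K \text{ for every } K\in Lat(A)\}$. An algebra $A\subset B(X)$ has split strict multiplicity $p\in\mathbb{N}$, written $s.s.m.(A)=p$, if there are $x_1,\dots,x_p\in X$ such that the subspaces $X_i=\{ax_i : a\in A\}$ are closed and $X=X_1\oplus\cdots\oplus X_p$ (such vectors are fixed; they "realize" the split strict multiplicity). Each $I_j$ is a closed ideal of $A$, and the map $S$ is a well-defined Banach space isomorphism. The radical of the abelian unital Banach algebra $A/I_j$ is the intersection of all its maximal ideals. *)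

theory Defs
  imports "HOL-Analysis.Analysis" "HOL-Algebra.QuotRing"
begin

section \<open>Complex Banach spaces\<close>

text \<open>HOL-Analysis only has real normed spaces. A complex normed space is a real normed space
  together with a complex scalar multiplication that extends the real one and for which the norm
  is absolutely homogeneous.\<close>

class complex_normed_vector = real_normed_vector +
  fixes scaleC :: "complex \<Rightarrow> 'a \<Rightarrow> 'a" (infixr "*\<^sub>C" 75)
  assumes scaleC_add_right: "c *\<^sub>C (x + y) = c *\<^sub>C x + c *\<^sub>C y"
    and scaleC_add_left: "(c + d) *\<^sub>C x = c *\<^sub>C x + d *\<^sub>C x"
    and scaleC_scaleC: "c *\<^sub>C (d *\<^sub>C x) = (c * d) *\<^sub>C x"
    and scaleC_of_real: "complex_of_real r *\<^sub>C x = r *\<^sub>R x"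
    and norm_scaleC: "norm (c *\<^sub>C x) = cmod c * norm x"

class complex_banach = complex_normed_vector + banach

instantiation complex :: complex_banach
begin

definition scaleC_complex :: "complex \<Rightarrow> complex \<Rightarrow> complex" where
  "scaleC_complex c x = c * x"

instance
  by standard (auto simp: scaleC_complex_def algebra_simps norm_mult scaleR_conv_of_real)

end

lemma scaleC_minus1: "(- 1) *\<^sub>C x = - (x :: 'a :: complex_normed_vector)"
  using scaleC_of_real[of "- 1" x] by simp

lemma bounded_linear_scaleC: "bounded_linear (\<lambda>x :: 'a :: complex_normed_vector. c *\<^sub>C x)"
proof (rule bounded_linear_intro)
  show "c *\<^sub>C (r *\<^sub>R x) = r *\<^sub>R (c *\<^sub>C x)" for r and x :: 'a
    by (simp add: scaleC_of_real[symmetric] scaleC_scaleC mult.commute)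
  show "norm (c *\<^sub>C x) \<le> norm x * cmod c" for x :: 'a
    by (simp add: norm_scaleC mult.commute)
qed (rule scaleC_add_right)

text \<open>Operators into a complex normed space are scaled pointwise.\<close>

instantiation blinfun :: (real_normed_vector, complex_normed_vector) complex_normed_vector
begin

lift_definition scaleC_blinfun :: "complex \<Rightarrow> 'a \<Rightarrow>\<^sub>L 'b \<Rightarrow> 'a \<Rightarrow>\<^sub>L 'b"
  is "\<lambda>c f x. c *\<^sub>C f x"
  by (rule bounded_linear_compose[OF bounded_linear_scaleC])

instance
proof
  fix c d :: complex and r :: real and f g :: "'a \<Rightarrow>\<^sub>L 'b"
  show "c *\<^sub>C (f + g) = c *\<^sub>C f + c *\<^sub>C g"
    by transfer (simp add: scaleC_add_right)
  show "(c + d) *\<^sub>C f = c *\<^sub>C f + d *\<^sub>C f"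
    by transfer (simp add: scaleC_add_left)
  show "c *\<^sub>C (d *\<^sub>C f) = (c * d) *\<^sub>C f"
    by transfer (simp add: scaleC_scaleC)
  show "complex_of_real r *\<^sub>C f = r *\<^sub>R f"
    by transfer (simp add: scaleC_of_real)
  have le: "norm (c *\<^sub>C f) \<le> cmod c * norm f" for c and f :: "'a \<Rightarrow>\<^sub>L 'b"
  proof (rule norm_blinfun_bound)
    show "norm (blinfun_apply (c *\<^sub>C f) x) \<le> cmod c * norm f * norm x" for x
      using mult_left_mono[OF norm_blinfun[of f x], of "cmod c"]
      by (simp add: scaleC_blinfun.rep_eq norm_scaleC mult.assoc)
  qed simp
  show "norm (c *\<^sub>C f) = cmod c * norm f"
  proof (cases "c = 0")
    case True
    then show ?thesis using le[of c f] by simp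
  next
    case False
    have one: "1 *\<^sub>C f = f"
      by transfer (simp add: scaleC_of_real[of 1, simplified])
    have "f = inverse c *\<^sub>C (c *\<^sub>C f)"
      using False one by (transfer; simp add: scaleC_scaleC)
    then have "norm f \<le> cmod (inverse c) * norm (c *\<^sub>C f)"
      using le[of "inverse c" "c *\<^sub>C f"] by simp
    then have "cmod c * norm f \<le> norm (c *\<^sub>C f)"
      using False by (simp add: norm_divide field_simps)
    then show ?thesis using le[of c f] by linarith
  qed
qed

end

instance blinfun :: (real_normed_vector, complex_banach) complex_banach ..

definition csubspace :: "'a :: complex_normed_vector set \<Rightarrow> bool" where
  "csubspace K \<longleftrightarrow> 0 \<in> K \<and> (\<forall>x\<in>K. \<forall>y\<in>K. x + y \<in> K) \<and> (\<forall>c. \<forall>x\<in>K. c *\<^sub>C x \<in> K)"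

section \<open>Operator algebras\<close>

text \<open>The type \<open>'a \<Rightarrow>\<^sub>L 'a\<close> consists of the bounded \<^emph>\<open>real\<close>-linear
  operators, with the operator norm. \<open>B(X)\<close> is the set of complex-linear ones. It is closed in
  \<^const>\<open>strong_operator_topology\<close>, so that a subset of it is strongly closed in
  \<open>B(X)\<close> iff it is closed in \<^const>\<open>strong_operator_topology\<close>.\<close>

definition bounded_ops :: "('a :: complex_normed_vector \<Rightarrow>\<^sub>L 'a) set" where
  "bounded_ops = {T. \<forall>c x. blinfun_apply T (c *\<^sub>C x) = c *\<^sub>C blinfun_apply T x}"

lemma closedin_bounded_ops:
  "closedin strong_operator_topology (bounded_ops :: ('a :: complex_normed_vector \<Rightarrow>\<^sub>L 'a) set)"
proof -
  let ?g = "\<lambda>c (x :: 'a) (T :: 'a \<Rightarrow>\<^sub>L 'a). blinfun_apply T (c *\<^sub>C x) - c *\<^sub>C blinfun_apply T x"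
  have "continuous_map strong_operator_topology euclidean (?g c x)" for c x
  proof -
    have "continuous_map euclidean euclidean (\<lambda>y :: 'a. c *\<^sub>C y)"
      by (simp add: linear_continuous_on[OF bounded_linear_scaleC])
    from continuous_map_compose[OF strong_operator_topology_continuous_evaluation[of x] this]
    show ?thesis
      by (intro continuous_map_diff strong_operator_topology_continuous_evaluation)
         (simp add: o_def)
  qed
  then have "closedin strong_operator_topology
      {T \<in> topspace strong_operator_topology. ?g c x T \<in> {0}}" for c x
    by (rule closedin_continuous_map_preimage) simp
  then have "closedin strong_operator_topology
      (\<Inter>(c, x) \<in> UNIV. {T \<in> topspace strong_operator_topology. ?g c x T \<in> {0}})"
    by (intro closedin_INT) auto
  moreover have "(\<Inter>(c, x) \<in> UNIV. {T \<in> topspace strong_operator_topology. ?g c x T \<in> {0}})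
      = bounded_ops"
    by (auto simp: bounded_ops_def strong_operator_topology_topspace)
  ultimately show ?thesis by simp
qed

definition abelian_unital_subalgebra :: "('a :: complex_normed_vector \<Rightarrow>\<^sub>L 'a) set \<Rightarrow> bool" where
  "abelian_unital_subalgebra A \<longleftrightarrow>
     A \<subseteq> bounded_ops \<and> csubspace A \<and> id_blinfun \<in> A \<and>
     (\<forall>a\<in>A. \<forall>b\<in>A. a o\<^sub>L b \<in> A) \<and>
     (\<forall>a\<in>A. \<forall>b\<in>A. a o\<^sub>L b = b o\<^sub>L a)"

definition Lat :: "('a :: complex_normed_vector \<Rightarrow>\<^sub>L 'a) set \<Rightarrow> 'a set set" where
  "Lat A = {K. csubspace K \<and> closed K \<and> (\<forall>a\<in>A. blinfun_apply a ` K \<subseteq> K)}"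

definition algLat :: "('a :: complex_normed_vector \<Rightarrow>\<^sub>L 'a) set \<Rightarrow> ('a \<Rightarrow>\<^sub>L 'a) set" where
  "algLat A = {T \<in> bounded_ops. \<forall>K\<in>Lat A. blinfun_apply T ` K \<subseteq> K}"

definition orbit_space :: "('a :: complex_normed_vector \<Rightarrow>\<^sub>L 'a) set \<Rightarrow> 'a \<Rightarrow> 'a set" where
  "orbit_space A x = {blinfun_apply a x | a. a \<in> A}"

text \<open>Families indexed by \<open>1, \<dots>, p\<close> are functions on \<^typ>\<open>nat\<close>; elements of a direct sum or
  product of \<open>p\<close> factors are the extensional functions in \<open>\<Pi>\<^sub>E j\<in>{1..p}. \<dots>\<close>.\<close>

definition internal_direct_sum :: "nat \<Rightarrow> (nat \<Rightarrow> 'a :: real_normed_vector set) \<Rightarrow> bool" where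
  "internal_direct_sum p M \<longleftrightarrow>
     (\<forall>z. \<exists>!y. y \<in> (\<Pi>\<^sub>E j\<in>{1..p}. M j) \<and> z = (\<Sum>j=1..p. y j))"

definition realizes_ssm ::
  "('a :: complex_normed_vector \<Rightarrow>\<^sub>L 'a) set \<Rightarrow> nat \<Rightarrow> (nat \<Rightarrow> 'a) \<Rightarrow> bool" where
  "realizes_ssm A p x \<longleftrightarrow>
     (\<forall>j\<in>{1..p}. closed (orbit_space A (x j))) \<and>
     internal_direct_sum p (\<lambda>j. orbit_space A (x j))"

section \<open>Quotients and radicals\<close>

definition op_ring :: "('a :: real_normed_vector \<Rightarrow>\<^sub>L 'a) set \<Rightarrow> ('a \<Rightarrow>\<^sub>L 'a) ring" where
  "op_ring A = \<lparr>carrier = A, mult = (o\<^sub>L), one = id_blinfun, zero = 0, add = (+)\<rparr>"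

definition annih :: "('a :: real_normed_vector \<Rightarrow>\<^sub>L 'a) set \<Rightarrow> 'a \<Rightarrow> ('a \<Rightarrow>\<^sub>L 'a) set" where
  "annih A x = {a \<in> A. blinfun_apply a x = 0}"

abbreviation quot_ring ::
  "('a :: real_normed_vector \<Rightarrow>\<^sub>L 'a) set \<Rightarrow> 'a \<Rightarrow> ('a \<Rightarrow>\<^sub>L 'a) set ring" where
  "quot_ring A x \<equiv> op_ring A Quot annih A x"

abbreviation quot_map ::
  "('a :: real_normed_vector \<Rightarrow>\<^sub>L 'a) set \<Rightarrow> 'a \<Rightarrow> ('a \<Rightarrow>\<^sub>L 'a) \<Rightarrow> ('a \<Rightarrow>\<^sub>L 'a) set" where
  "quot_map A x a \<equiv> annih A x +>\<^bsub>op_ring A\<^esub> a"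

text \<open>For the unital algebras \<open>A / I\<^sub>j\<close> ring ideals and algebra ideals coincide, so the
  library notion of maximal ideal applies. Intersecting with the carrier makes the radical of
  the zero ring (which has no maximal ideals) the zero ring itself.\<close>

definition radical :: "('r, 'm) ring_scheme \<Rightarrow> 'r set" where
  "radical R = carrier R \<inter> \<Inter>{M. maximalideal M R}"

text \<open>All elements \<open>a\<close> of a coset \<open>q j\<close> of \<open>annih A (x j)\<close> have the same value at \<open>x j\<close>;
  \<open>ssm_map\<close> adds up these values. This is the map \<open>S\<close>: see \<open>ssm_map_quot_map\<close> and
  \<open>bij_betw_ssm_map\<close> below.\<close>

definition ssm_map :: "nat \<Rightarrow> (nat \<Rightarrow> 'a :: real_normed_vector) \<Rightarrow>
    (nat \<Rightarrow> ('a \<Rightarrow>\<^sub>L 'a) set) \<Rightarrow> 'a" where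
  "ssm_map p x q = (\<Sum>j=1..p. the_elem ((\<lambda>a. blinfun_apply a (x j)) ` q j))"

lemma abelian_unital_subalgebraD:
  assumes "abelian_unital_subalgebra A"
  shows "0 \<in> A" "id_blinfun \<in> A"
    "\<And>a b. a \<in> A \<Longrightarrow> b \<in> A \<Longrightarrow> a + b \<in> A"
    "\<And>a. a \<in> A \<Longrightarrow> - a \<in> A"
    "\<And>a b. a \<in> A \<Longrightarrow> b \<in> A \<Longrightarrow> a o\<^sub>L b \<in> A"
    "\<And>a b. a \<in> A \<Longrightarrow> b \<in> A \<Longrightarrow> a o\<^sub>L b = b o\<^sub>L a"
proof -
  show "- a \<in> A" if "a \<in> A" for a
  proof -
    have "(- 1) *\<^sub>C a \<in> A"
      using assms that unfolding abelian_unital_subalgebra_def csubspace_def by blast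
    then show ?thesis by (simp only: scaleC_minus1)
  qed
qed (use assms in \<open>auto simp: abelian_unital_subalgebra_def csubspace_def\<close>)

lemma cring_op_ring:
  assumes "abelian_unital_subalgebra A"
  shows "cring (op_ring A)"
proof -
  note A = abelian_unital_subalgebraD[OF assms]
  have inv: "\<exists>y\<in>A. y + a = 0" if "a \<in> A" for a
    using A(4)[OF that] by (intro bexI[of _ "- a"]) auto
  show ?thesis
  proof (rule cringI)
    show "abelian_group (op_ring A)"
      by (rule abelian_groupI) (use A(1,3) inv in \<open>auto simp: op_ring_def add_ac\<close>)
    show "comm_monoid (op_ring A)"
    proof (rule comm_monoidI)
      show "a \<otimes>\<^bsub>op_ring A\<^esub> b = b \<otimes>\<^bsub>op_ring A\<^esub> a"
        if "a \<in> carrier (op_ring A)" "b \<in> carrier (op_ring A)" for a b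
        using A(6)[of a b] that by (simp add: op_ring_def)
    qed (use A(2,5) in \<open>auto simp: op_ring_def intro: blinfun_eqI\<close>)
  qed (auto simp: op_ring_def blinfun.add_left intro: blinfun_eqI)
qed

lemma ideal_annih:
  assumes "abelian_unital_subalgebra A"
  shows "ideal (annih A x) (op_ring A)"
proof -
  note A = abelian_unital_subalgebraD[OF assms]
  interpret cring "op_ring A" by (rule cring_op_ring[OF assms])
  have minus: "\<ominus>\<^bsub>op_ring A\<^esub> a = - a" if "a \<in> A" for a
    using A(4)[OF that] that by (intro minus_equality) (auto simp: op_ring_def)
  have comp: "blinfun_apply (a o\<^sub>L b) x = 0" "blinfun_apply (b o\<^sub>L a) x = 0"
    if "a \<in> A" "b \<in> A" "blinfun_apply a x = 0" for a b
    using A(6)[OF that(1,2)] that(3) by auto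
  show ?thesis
  proof (rule idealI)
    show "subgroup (annih A x) (add_monoid (op_ring A))"
    proof (rule add.subgroupI)
      show "\<ominus>\<^bsub>op_ring A\<^esub> a \<in> annih A x" if "a \<in> annih A x" for a
        using that A(4) by (auto simp: annih_def minus blinfun.minus_left)
    qed (use A(1,3) in \<open>auto simp: annih_def op_ring_def blinfun.add_left\<close>)
  qed (use A(5) comp in \<open>auto simp: op_ring_def annih_def intro: ring_axioms[unfolded op_ring_def]\<close>)
qed

lemma eval_quot_map:
  assumes "abelian_unital_subalgebra A" "a \<in> A"
  shows "(\<lambda>b. blinfun_apply b x) ` quot_map A x a = {blinfun_apply a x}"
proof -
  have "0 \<in> annih A x"
    using abelian_unital_subalgebraD(1)[OF assms(1)] by (simp add: annih_def)
  then show ?thesis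
    by (auto simp: a_r_coset_def r_coset_def op_ring_def annih_def blinfun.add_left image_iff)
qed

lemma ssm_map_quot_map:
  assumes "abelian_unital_subalgebra A" "\<And>j. j \<in> {1..p} \<Longrightarrow> a j \<in> A"
  shows "ssm_map p x (\<lambda>j\<in>{1..p}. quot_map A (x j) (a j)) = (\<Sum>j=1..p. blinfun_apply (a j) (x j))"
  unfolding ssm_map_def using assms by (intro sum.cong) (auto simp: eval_quot_map)

lemma carrier_quot_ring: "carrier (quot_ring A x) = quot_map A x ` A"
  by (auto simp: FactRing_def A_RCOSETS_defs a_r_coset_def r_coset_def op_ring_def)

lemma quot_map_eqI:
  assumes "abelian_unital_subalgebra A" "a \<in> A" "b \<in> A" "blinfun_apply a x = blinfun_apply b x"
  shows "quot_map A x a = quot_map A x b"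
proof -
  have sub: "quot_map A x a \<subseteq> quot_map A x b"
    if "a \<in> A" "b \<in> A" "blinfun_apply a x = blinfun_apply b x" for a b
  proof
    fix u assume "u \<in> quot_map A x a"
    then obtain h where h: "h \<in> annih A x" "u = h + a"
      by (auto simp: a_r_coset_def r_coset_def op_ring_def)
    have "h + a + - b \<in> A"
      using h that unfolding annih_def
      by (intro abelian_unital_subalgebraD(3,4)[OF assms(1)]) auto
    then have "h + a - b \<in> annih A x"
      using h that by (simp add: annih_def blinfun.add_left blinfun.diff_left)
    then show "u \<in> quot_map A x b"
      using h by (force simp: a_r_coset_def r_coset_def op_ring_def)
  qed
  show ?thesis using sub[of a b] sub[of b a] assms by auto
qed

lemma bij_betw_ssm_map:
  assumes "abelian_unital_subalgebra A" "realizes_ssm A p x"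
  shows "bij_betw (ssm_map p x) (\<Pi>\<^sub>E j\<in>{1..p}. carrier (quot_ring A (x j))) UNIV"
proof -
  have rep: "\<exists>a. (\<forall>j\<in>{1..p}. a j \<in> A) \<and> q = (\<lambda>j\<in>{1..p}. quot_map A (x j) (a j))"
    if q: "q \<in> (\<Pi>\<^sub>E j\<in>{1..p}. carrier (quot_ring A (x j)))" for q
  proof -
    have "\<forall>j\<in>{1..p}. \<exists>a\<in>A. q j = quot_map A (x j) a"
      using q by (fastforce simp: carrier_quot_ring PiE_iff)
    then obtain a where "\<forall>j\<in>{1..p}. a j \<in> A \<and> q j = quot_map A (x j) (a j)"
      by metis
    then show ?thesis
      using q by (intro exI[of _ a]) (auto simp: PiE_iff extensional_def fun_eq_iff)
  qed
  have dec: "\<exists>!y. y \<in> (\<Pi>\<^sub>E j\<in>{1..p}. orbit_space A (x j)) \<and> z = (\<Sum>j=1..p. y j)" for z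
    using assms(2) by (auto simp: realizes_ssm_def internal_direct_sum_def)
  show ?thesis
  proof (rule bij_betwI')
    fix q r
    assume q: "q \<in> (\<Pi>\<^sub>E j\<in>{1..p}. carrier (quot_ring A (x j)))"
      and r: "r \<in> (\<Pi>\<^sub>E j\<in>{1..p}. carrier (quot_ring A (x j)))"
    obtain a where
        a: "\<forall>j\<in>{1..p}. a j \<in> A" "q = (\<lambda>j\<in>{1..p}. quot_map A (x j) (a j))"
      using rep[OF q] by blast
    obtain b where
        b: "\<forall>j\<in>{1..p}. b j \<in> A" "r = (\<lambda>j\<in>{1..p}. quot_map A (x j) (b j))"
      using rep[OF r] by blast
    have "q = r" if eq: "ssm_map p x q = ssm_map p x r"
    proof -
      let ?y = "\<lambda>a. \<lambda>j\<in>{1..p}. blinfun_apply (a j) (x j)"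
      have "?y a \<in> (\<Pi>\<^sub>E j\<in>{1..p}. orbit_space A (x j))"
           "?y b \<in> (\<Pi>\<^sub>E j\<in>{1..p}. orbit_space A (x j))"
        using a(1) b(1) by (auto simp: orbit_space_def)
      moreover have "(\<Sum>j=1..p. ?y a j) = (\<Sum>j=1..p. ?y b j)"
        using eq ssm_map_quot_map[OF assms(1), of p a x] ssm_map_quot_map[OF assms(1), of p b x] a b
        by simp
      ultimately have y: "?y a = ?y b"
        using dec[of "\<Sum>j=1..p. ?y a j"] by blast
      have ab: "blinfun_apply (a j) (x j) = blinfun_apply (b j) (x j)" if "j \<in> {1..p}" for j
        using fun_cong[OF y, of j] that by simp
      show ?thesis
        unfolding a(2) b(2)
      proof (rule restrict_ext)
        fix j assume j: "j \<in> {1..p}"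
        show "quot_map A (x j) (a j) = quot_map A (x j) (b j)"
          by (rule quot_map_eqI[OF assms(1) bspec[OF a(1) j] bspec[OF b(1) j] ab[OF j]])
      qed
    qed
    then show "(ssm_map p x q = ssm_map p x r) = (q = r)" by blast
  next
    fix z :: 'a
    obtain y where y: "y \<in> (\<Pi>\<^sub>E j\<in>{1..p}. orbit_space A (x j))" "z = (\<Sum>j=1..p. y j)"
      using dec[of z] by blast
    then have "\<forall>j\<in>{1..p}. \<exists>a\<in>A. y j = blinfun_apply a (x j)"
      by (fastforce simp: orbit_space_def PiE_iff)
    then obtain a where a: "\<forall>j\<in>{1..p}. a j \<in> A \<and> y j = blinfun_apply (a j) (x j)"
      by metis
    then have "z = ssm_map p x (\<lambda>j\<in>{1..p}. quot_map A (x j) (a j))"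
      using y(2) by (subst ssm_map_quot_map[OF assms(1)]) auto
    moreover have "(\<lambda>j\<in>{1..p}. quot_map A (x j) (a j)) \<in>
        (\<Pi>\<^sub>E j\<in>{1..p}. carrier (quot_ring A (x j)))"
      using a by (auto simp: carrier_quot_ring)
    ultimately show "\<exists>q\<in>(\<Pi>\<^sub>E j\<in>{1..p}. carrier (quot_ring A (x j))). z = ssm_map p x q"
      by blast
  qed simp
qed

end

theory Submission
  imports Defs
begin

text \<open>Every \<open>A x\<^sub>j\<close> is closed, so \<open>T x\<^sub>j \<in> A x\<^sub>j\<close>. Applying \<open>T \<in> algLat A\<close> to the diagonal vector
  \<open>x\<^sub>1 + \<dots> + x\<^sub>p\<close> gives a sequence \<open>a\<^sub>n\<close> in \<open>A\<close> with \<open>a\<^sub>n x\<^sub>j \<longlonglongrightarrow> T x\<^sub>j\<close> for all \<open>j\<close> at once; by the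
  open mapping theorem it converges strongly, so its limit \<open>a\<^sub>0\<close> lies in \<open>A\<close>, and \<open>T - a\<^sub>0\<close> kills
  every \<open>x\<^sub>j\<close>. If \<open>J\<close> is the preimage in \<open>A\<close> of a maximal ideal of \<open>A / I\<^sub>j\<close>, then the vectors whose
  \<open>j\<close>-th coefficient lies in \<open>J\<close> form a closed invariant subspace \<open>K\<close>. By Gelfand--Mazur \<open>J\<close> has
  codimension one in \<open>A\<close>, so every vector lies in \<open>K\<close> up to a multiple of \<open>x\<^sub>j\<close>, and therefore
  \<open>T - a\<^sub>0\<close> maps all of \<open>X\<close> into \<open>K\<close>.

  The functional-analytic form of Gelfand--Mazur would need the Hahn--Banach theorem. Instead we use
  the proof by means over roots of unity (Rickart): the mean of \<open>(1 - \<omega> r a)\<^sup>-\<^sup>1\<close> over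
  \<open>\<omega>^n = 1\<close> is \<open>(1 - r^n a^n)\<^sup>-\<^sup>1\<close>, so if all these inverses exist then \<open>r^n a^n\<close> tends to \<open>0\<close> for
  every \<open>r\<close>, which is absurd when \<open>a\<close> is invertible.\<close>

section \<open>The Gelfand--Mazur theorem\<close>

text \<open>The field is the quotient of \<open>A\<close> by \<open>{u \<in> A. q u = 0}\<close>, which is never formed: equality in it is
  \<open>q (u - v) = 0\<close>.\<close>

locale seminormed_quotient_field =
  fixes A :: "'r::ab_group_add set" and mult :: "'r \<Rightarrow> 'r \<Rightarrow> 'r" (infixl "\<odot>" 70)
    and e :: 'r and emb :: "complex \<Rightarrow> 'r" and q :: "'r \<Rightarrow> real"
  assumes zero_closed [simp]: "0 \<in> A"
    and add_closed [simp]: "\<lbrakk>u \<in> A; v \<in> A\<rbrakk> \<Longrightarrow> u + v \<in> A"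
    and uminus_closed [simp]: "u \<in> A \<Longrightarrow> - u \<in> A"
    and mult_closed [simp]: "\<lbrakk>u \<in> A; v \<in> A\<rbrakk> \<Longrightarrow> u \<odot> v \<in> A"
    and one_closed [simp]: "e \<in> A"
    and emb_closed [simp]: "emb c \<in> A"
    and mult_assoc: "\<lbrakk>u \<in> A; v \<in> A; w \<in> A\<rbrakk> \<Longrightarrow> u \<odot> v \<odot> w = u \<odot> (v \<odot> w)"
    and mult_comm: "\<lbrakk>u \<in> A; v \<in> A\<rbrakk> \<Longrightarrow> u \<odot> v = v \<odot> u"
    and distrib_left: "\<lbrakk>u \<in> A; v \<in> A; w \<in> A\<rbrakk> \<Longrightarrow> u \<odot> (v + w) = u \<odot> v + u \<odot> w"
    and one_mult [simp]: "u \<in> A \<Longrightarrow> e \<odot> u = u"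
    and emb_add: "emb (c + d) = emb c + emb d"
    and emb_mult: "emb (c * d) = emb c \<odot> emb d"
    and emb_1: "emb 1 = e"
    and q_nonneg [simp]: "0 \<le> q u"
    and q_add: "\<lbrakk>u \<in> A; v \<in> A\<rbrakk> \<Longrightarrow> q (u + v) \<le> q u + q v"
    and q_mult: "\<lbrakk>u \<in> A; v \<in> A\<rbrakk> \<Longrightarrow> q (u \<odot> v) \<le> q u * q v"
    and q_emb: "u \<in> A \<Longrightarrow> q (emb c \<odot> u) \<le> cmod c * q u"
    and q_one: "q e > 0"
    and inverse_ex: "\<lbrakk>u \<in> A; q u \<noteq> 0\<rbrakk> \<Longrightarrow> \<exists>v\<in>A. q (v \<odot> u - e) = 0"
begin

section \<open>Ring arithmetic and seminorm calculus modulo the kernel of \<open>q\<close>\<close>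

lemma diff_closed [simp]: "\<lbrakk>u \<in> A; v \<in> A\<rbrakk> \<Longrightarrow> u - v \<in> A"
  using add_closed[of u "- v"] by simp

lemma sum_closed [simp]: "(\<And>i. i \<in> I \<Longrightarrow> f i \<in> A) \<Longrightarrow> sum f I \<in> A"
  by (induction I rule: infinite_finite_induct) auto

lemma mult_left_comm: "\<lbrakk>u \<in> A; v \<in> A; w \<in> A\<rbrakk> \<Longrightarrow> u \<odot> (v \<odot> w) = v \<odot> (u \<odot> w)"
  by (metis mult_assoc mult_comm)

lemma mult_one [simp]: "u \<in> A \<Longrightarrow> u \<odot> e = u"
  by (simp add: mult_comm[of u e])

lemma mult_zero [simp]: "u \<in> A \<Longrightarrow> u \<odot> 0 = 0"
  using distrib_left[of u 0 0] by simp

lemma zero_mult [simp]: "u \<in> A \<Longrightarrow> 0 \<odot> u = 0"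
  by (simp add: mult_comm[of 0 u])

lemma mult_minus: "\<lbrakk>u \<in> A; v \<in> A\<rbrakk> \<Longrightarrow> u \<odot> (- v) = - (u \<odot> v)"
  using distrib_left[of u v "- v"] by (simp add: eq_neg_iff_add_eq_0 add.commute)

lemma minus_mult: "\<lbrakk>u \<in> A; v \<in> A\<rbrakk> \<Longrightarrow> (- u) \<odot> v = - (u \<odot> v)"
  by (metis mult_comm mult_minus uminus_closed)

lemma mult_diff: "\<lbrakk>u \<in> A; v \<in> A; w \<in> A\<rbrakk> \<Longrightarrow> u \<odot> (v - w) = u \<odot> v - u \<odot> w"
  using distrib_left[of u v "- w"] by (simp add: mult_minus)

lemma distrib_right: "\<lbrakk>u \<in> A; v \<in> A; w \<in> A\<rbrakk> \<Longrightarrow> (v + w) \<odot> u = v \<odot> u + w \<odot> u"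
  by (metis distrib_left mult_comm add_closed)

lemma diff_mult: "\<lbrakk>u \<in> A; v \<in> A; w \<in> A\<rbrakk> \<Longrightarrow> (v - w) \<odot> u = v \<odot> u - w \<odot> u"
  by (metis mult_diff mult_comm diff_closed)

lemmas ring_rules = mult_assoc mult_comm mult_left_comm mult_minus minus_mult
  distrib_left distrib_right mult_diff diff_mult

lemma sum_mult: "\<lbrakk>\<And>i. i \<in> I \<Longrightarrow> f i \<in> A; u \<in> A\<rbrakk> \<Longrightarrow> sum f I \<odot> u = (\<Sum>i\<in>I. f i \<odot> u)"
  by (induction I rule: infinite_finite_induct) (auto simp: distrib_right)

lemma emb_0 [simp]: "emb 0 = 0"
  using emb_add[of 0 0] by simp

lemma emb_uminus: "emb (- c) = - emb c"
  using emb_add[of c "- c"] by (simp add: eq_neg_iff_add_eq_0 add.commute)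

lemma emb_diff: "emb (c - d) = emb c - emb d"
  using emb_add[of c "- d"] by (simp add: emb_uminus)

lemma emb_sum: "emb (sum f I) = (\<Sum>i\<in>I. emb (f i))"
  by (induction I rule: infinite_finite_induct) (auto simp: emb_add)

text \<open>Multiplication by \<open>emb (1 / c)\<close> undoes multiplication by
  \<open>emb c\<close>, so the inequality \<open>q_emb\<close> applied to \<open>1 / c\<close>
  supplies the reverse bound.\<close>

lemma q_emb_eq:
  assumes u: "u \<in> A" shows "q (emb c \<odot> u) = cmod c * q u"
proof (cases "c = 0")
  case True
  then show ?thesis using q_emb[OF u, of 0] q_nonneg[of 0] u by (simp add: antisym)
next
  case False
  have "u = emb (1 / c) \<odot> (emb c \<odot> u)"
    using False u by (simp add: mult_assoc[symmetric] emb_mult[symmetric] emb_1)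
  then have "q u \<le> cmod (1 / c) * q (emb c \<odot> u)"
    using q_emb[of "emb c \<odot> u" "1 / c"] u by simp
  then have "cmod c * q u \<le> q (emb c \<odot> u)"
    using False by (simp add: norm_divide field_simps)
  then show ?thesis using q_emb[OF u, of c] by linarith
qed

lemma q_zero [simp]: "q 0 = 0"
  using q_emb_eq[of 0 0] by simp

lemma q_uminus: "u \<in> A \<Longrightarrow> q (- u) = q u"
  using q_emb_eq[of u "- 1"] by (simp add: emb_uminus emb_1 minus_mult)

lemma q_diff: "\<lbrakk>u \<in> A; v \<in> A\<rbrakk> \<Longrightarrow> q (u - v) \<le> q u + q v"
  using q_add[of u "- v"] q_uminus[of v] by simp

lemma q_sum: "(\<And>i. i \<in> I \<Longrightarrow> f i \<in> A) \<Longrightarrow> q (sum f I) \<le> (\<Sum>i\<in>I. q (f i))"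
proof (induction I rule: infinite_finite_induct)
  case (insert i I)
  then have "q (f i + sum f I) \<le> q (f i) + q (sum f I)" by (intro q_add) auto
  then show ?case using insert by fastforce
qed auto

lemma q_mult_zero: "\<lbrakk>u \<in> A; v \<in> A; q v = 0\<rbrakk> \<Longrightarrow> q (u \<odot> v) = 0"
  using q_mult[of u v] q_nonneg[of "u \<odot> v"] by simp

text \<open>This makes \<open>q (u - v) = 0\<close> usable as a congruence.\<close>
lemma q_perturb: "\<lbrakk>u \<in> A; v \<in> A; q (u - v) = 0\<rbrakk> \<Longrightarrow> q u = q v"
  using q_add[of "u - v" v] q_diff[of u "u - v"] by simp

primrec pow :: "'r \<Rightarrow> nat \<Rightarrow> 'r" where
  "pow u 0 = e"
| "pow u (Suc n) = u \<odot> pow u n"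

lemma pow_closed [simp]: "u \<in> A \<Longrightarrow> pow u n \<in> A"
  by (induction n) auto

lemma pow_emb_mult: "u \<in> A \<Longrightarrow> pow (emb c \<odot> u) n = emb (c ^ n) \<odot> pow u n"
  by (induction n) (auto simp: emb_1 emb_mult mult_assoc mult_left_comm)

lemma geometric_sum: "u \<in> A \<Longrightarrow> (e - u) \<odot> (\<Sum>m<n. pow u m) = e - pow u n"
proof (induction n)
  case (Suc n)
  have "(e - u) \<odot> (\<Sum>m<Suc n. pow u m) = (e - u) \<odot> (\<Sum>m<n. pow u m) + (e - u) \<odot> pow u n"
    using Suc.prems by (simp add: distrib_left)
  also have "\<dots> = e - pow u n + (pow u n - u \<odot> pow u n)"
    using Suc by (simp add: diff_mult)
  finally show ?case by simp
qed auto

end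

text \<open>For \<open>m \<noteq> 0\<close> this is a geometric sum of length \<open>n\<close> whose
  ratio is an \<open>n\<close>-th root of unity. The ratio is not 1, since otherwise
  \<open>n\<close> would divide \<open>m\<close>, so the sum vanishes.\<close>

lemma sum_powers_root_of_unity:
  fixes m n :: nat
  assumes "0 < n" "m < n"
  shows "(\<Sum>k<n. (cis (2 * pi / n) ^ k) ^ m) = (if m = 0 then of_nat n else 0)"
proof (cases "m = 0")
  case False
  let ?z = "cis (2 * pi / n) ^ m"
  have "?z \<noteq> 1"
  proof
    assume "?z = 1"
    then have "cis (m * (2 * pi / n)) = 1" by (simp only: Complex.DeMoivre)
    then have "cos (m * (2 * pi / n)) = 1" by (metis cis.sel(1) one_complex.sel(1))
    then have "cos (2 * pi * m / n) = 1" by (simp add: mult_ac)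
    then obtain i :: int where "2 * pi * m / n = of_int i * 2 * pi"
      by (metis cos_one_2pi_int)
    then have "real m = i * real n" using assms by (simp add: field_simps)
    then have "int m = i * int n" by (metis of_int_eq_iff of_int_mult of_int_of_nat_eq)
    then have "int n dvd int m" by simp
    then show False using False assms by (auto dest: dvd_imp_le)
  qed
  moreover have "?z ^ n = 1"
  proof -
    have "?z ^ n = (cis (2 * pi / n) ^ n) ^ m" by (metis power_mult mult.commute)
    then show ?thesis using assms by (simp add: Complex.DeMoivre)
  qed
  ultimately have "(\<Sum>k<n. ?z ^ k) = 0" by (simp add: sum_gp_strict)
  moreover have "(cis (2 * pi / n) ^ k) ^ m = ?z ^ k" for k
    by (metis power_mult mult.commute)
  ultimately show ?thesis using False by simp
qed simp

section \<open>Resolvents and their means over circles\<close>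

context seminormed_quotient_field
begin

text \<open>The situation to be refuted: \<open>g c\<close> inverts
  \<open>e - emb c \<odot> a\<close> modulo the kernel of \<open>q\<close> for every complex
  \<open>c\<close>. Nothing is assumed about how \<open>g\<close> depends on \<open>c\<close>; the
  needed regularity is derived.\<close>

context
  fixes a :: 'r and g :: "complex \<Rightarrow> 'r"
  assumes a: "a \<in> A" and g: "\<And>c. g c \<in> A"
    and res: "\<And>c. q (g c \<odot> (e - emb c \<odot> a) - e) = 0"
begin

text \<open>This is the resolvent identity: modulo the kernel of \<open>q\<close>,
  \<open>g c - g d\<close> equals \<open>(c - d)\<close> times
  \<open>a \<odot> (g c \<odot> g d)\<close>.\<close>

lemma resolvent_diff_le: "q (g c - g d) \<le> cmod (c - d) * (q a * q (g c) * q (g d))"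
proof -
  note [simp] = a g
  let ?E = "\<lambda>c. g c \<odot> (e - emb c \<odot> a) - e"
  let ?p = "emb (c - d) \<odot> (a \<odot> (g c \<odot> g d))"
  have "q (g d \<odot> ?E c - g c \<odot> ?E d) \<le> q (g d \<odot> ?E c) + q (g c \<odot> ?E d)"
    by (intro q_diff) auto
  also have "\<dots> = 0"
    using q_mult_zero[of "g d" "?E c"] q_mult_zero[of "g c" "?E d"] res by simp
  finally have "q (g d \<odot> ?E c - g c \<odot> ?E d) = 0"
    by (intro antisym) auto
  moreover have "(g c - g d) - ?p = g d \<odot> ?E c - g c \<odot> ?E d"
    by (simp add: ring_rules emb_diff)
  ultimately have "q (g c - g d) = q ?p"
    by (intro q_perturb) auto
  also have "\<dots> = cmod (c - d) * q (a \<odot> (g c \<odot> g d))"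
    by (rule q_emb_eq) auto
  also have "q (a \<odot> (g c \<odot> g d)) \<le> q a * (q (g c) * q (g d))"
    by (rule order.trans[OF q_mult mult_left_mono[OF q_mult]]) auto
  finally show ?thesis by (simp add: mult.assoc mult_left_mono)
qed

text \<open>The resolvent identity bounds \<open>q (g c)\<close> by \<open>2 * q (g d)\<close> for
  \<open>c\<close> near \<open>d\<close>; compactness of the disc leaves finitely many such
  \<open>d\<close>.\<close>

lemma resolvent_bounded: "\<exists>B\<ge>0. \<forall>c\<in>cball 0 R. q (g c) \<le> B"
proof -
  \<comment> \<open>The radius makes \<open>cmod (c - d) * q a * q (g d)\<close> at most 1/2, so
    half of \<open>q (g c)\<close> can be absorbed on the left. Adding 1 keeps the denominator
    positive.\<close>
  define r where "r d = 1 / (2 * (q a * q (g d) + 1))" for d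
  have pos: "q a * q (g d) + 1 > 0" for d
    by (simp add: add_nonneg_pos)
  have loc: "q (g c) \<le> 2 * q (g d)" if "c \<in> ball d (r d)" for c d
  proof -
    have "cmod (c - d) * (q a * q (g d)) \<le> r d * (q a * q (g d))"
      using that by (intro mult_right_mono) (auto simp: dist_norm norm_minus_commute)
    also have "\<dots> \<le> 1 / 2"
      using pos[of d] by (simp add: r_def field_simps)
    finally have *: "cmod (c - d) * (q a * q (g d)) \<le> 1 / 2" .
    have "q (g c) \<le> q (g d) + q (g c - g d)"
      using q_add[of "g d" "g c - g d"] g by simp
    also have "q (g c - g d) \<le> cmod (c - d) * (q a * q (g d)) * q (g c)"
      using resolvent_diff_le[of c d] by (simp add: mult_ac)
    also have "\<dots> \<le> 1 / 2 * q (g c)"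
      using * by (intro mult_right_mono) auto
    finally show ?thesis by simp
  qed
  have "compact (cball (0 :: complex) R)" by simp
  moreover have "\<And>d. d \<in> cball 0 R \<Longrightarrow> open (ball d (r d))" by simp
  moreover have "cball 0 R \<subseteq> (\<Union>d\<in>cball 0 R. ball d (r d))"
  proof
    fix d assume "d \<in> cball (0 :: complex) R"
    moreover have "d \<in> ball d (r d)" using pos[of d] by (simp add: r_def)
    ultimately show "d \<in> (\<Union>d\<in>cball 0 R. ball d (r d))" by blast
  qed
  ultimately obtain D where D: "finite D" "D \<subseteq> cball 0 R" "cball 0 R \<subseteq> (\<Union>d\<in>D. ball d (r d))"
    by (rule compactE_image)
  show ?thesis
  proof (intro exI[of _ "\<Sum>d\<in>D. 2 * q (g d)"] conjI ballI)
    fix c assume "c \<in> cball (0 :: complex) R"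
    then obtain d where d: "d \<in> D" "c \<in> ball d (r d)" using D(3) by blast
    have "q (g c) \<le> 2 * q (g d)" using loc d(2) .
    also have "\<dots> \<le> (\<Sum>d\<in>D. 2 * q (g d))" by (rule member_le_sum) (use d D in auto)
    finally show "q (g c) \<le> (\<Sum>d\<in>D. 2 * q (g d))" .
  qed (auto intro: sum_nonneg)
qed

text \<open>A discrete substitute for the Cauchy integral of \<open>g\<close> over the circle of
  radius \<open>r\<close>. For \<open>n = 0\<close> it is 0, hence the condition
  \<open>n > 0\<close> in the estimates.\<close>

definition circle_mean :: "nat \<Rightarrow> real \<Rightarrow> 'r" where
  "circle_mean n r = emb (1 / of_nat n) \<odot> (\<Sum>k<n. g (cis (2 * pi / n) ^ k * of_real r))"

lemma circle_mean_closed [simp]: "circle_mean n r \<in> A"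
  by (simp add: circle_mean_def g)

lemma circle_mean_le:
  assumes "\<forall>c\<in>cball 0 R. q (g c) \<le> B" "0 \<le> r" "r \<le> R" "n > 0"
  shows "q (circle_mean n r) \<le> B"
proof -
  have "q (circle_mean n r) = 1 / n * q (\<Sum>k<n. g (cis (2 * pi / n) ^ k * of_real r))"
    unfolding circle_mean_def by (subst q_emb_eq) (auto simp: g norm_divide)
  also have "\<dots> \<le> 1 / n * (\<Sum>k<n. q (g (cis (2 * pi / n) ^ k * of_real r)))"
    by (intro mult_left_mono q_sum) (auto simp: g)
  also have "\<dots> \<le> 1 / n * (\<Sum>k<n. B)"
    using assms by (intro mult_left_mono sum_mono) (auto simp: norm_mult norm_power)
  finally show ?thesis using assms by simp
qed

text \<open>Points at the same angle on the two circles lie at distance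
  \<open>\<bar>s - r\<bar>\<close>. What matters is that the Lipschitz constant does not depend on
  \<open>n\<close>.\<close>

lemma circle_mean_diff_le:
  assumes B: "\<forall>c\<in>cball 0 R. q (g c) \<le> B" "0 \<le> r" "r \<le> R" "0 \<le> s" "s \<le> R" "n > 0"
  shows "q (circle_mean n s - circle_mean n r) \<le> q a * B * B * \<bar>s - r\<bar>"
proof -
  let ?c = "\<lambda>k r. cis (2 * pi / n) ^ k * complex_of_real r"
  have B0: "B \<ge> 0" using B(1)[rule_format, of 0] B(2,3) order.trans[OF q_nonneg[of "g 0"]] by simp
  have *: "q (g (?c k s) - g (?c k r)) \<le> q a * B * B * \<bar>s - r\<bar>" for k
  proof -
    have "q (g (?c k s) - g (?c k r))
        \<le> cmod (?c k s - ?c k r) * (q a * q (g (?c k s)) * q (g (?c k r)))"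
      by (rule resolvent_diff_le)
    also have "\<dots> \<le> cmod (?c k s - ?c k r) * (q a * B * B)"
      using B B0 by (intro mult_left_mono mult_mono) (auto simp: norm_mult norm_power)
    also have "cmod (?c k s - ?c k r) = \<bar>s - r\<bar>"
      by (simp add: right_diff_distrib[symmetric] norm_mult norm_power of_real_diff[symmetric]
          del: of_real_diff)
    finally show ?thesis by (simp add: mult_ac)
  qed
  have "circle_mean n s - circle_mean n r = emb (1 / of_nat n) \<odot> (\<Sum>k<n. g (?c k s) - g (?c k r))"
    unfolding circle_mean_def by (subst mult_diff[symmetric]) (auto simp: g sum_subtractf)
  then have "q (circle_mean n s - circle_mean n r) = 1 / n * q (\<Sum>k<n. g (?c k s) - g (?c k r))"
    by (simp add: q_emb_eq g norm_divide)
  also have "\<dots> \<le> 1 / n * (\<Sum>k<n. q (g (?c k s) - g (?c k r)))"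
    by (intro mult_left_mono q_sum) (auto simp: g)
  also have "\<dots> \<le> 1 / n * (\<Sum>k<n. q a * B * B * \<bar>s - r\<bar>)"
    using * by (intro mult_left_mono sum_mono) auto
  finally show ?thesis using B by simp
qed

text \<open>Every sample point \<open>c\<close> has \<open>c ^ n = r ^ n\<close>, so
  \<open>e - emb (c ^ n) \<odot> pow a n\<close> is the same for all of them and factors as
  \<open>e - emb c \<odot> a\<close> times a geometric sum. Multiplication by \<open>g c\<close>
  leaves that sum, and averaging over the roots of unity removes all of its powers except the
  zeroth.\<close>

lemma circle_mean_inverse:
  assumes n: "n > 0"
  shows "q (circle_mean n r \<odot> (e - emb (of_real r ^ n) \<odot> pow a n) - e) = 0"
proof -
  note [simp] = a g
  let ?c = "\<lambda>k. cis (2 * pi / n) ^ k * complex_of_real r"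
  let ?u = "e - emb (of_real r ^ n) \<odot> pow a n"
  let ?P = "\<lambda>k. \<Sum>m<n. pow (emb (?c k) \<odot> a) m"
  have c: "?c k ^ n = of_real r ^ n" for k
  proof -
    have "(cis (2 * pi / n) ^ k) ^ n = (cis (2 * pi / n) ^ n) ^ k"
      by (metis power_mult mult.commute)
    also have "cis (2 * pi / n) ^ n = 1" using n by (simp add: Complex.DeMoivre)
    also have "1 ^ k = (1 :: complex)" by simp
    finally show ?thesis by (simp add: power_mult_distrib)
  qed
  have aux: "u \<odot> (v \<odot> w) - w = w \<odot> (u \<odot> v - e)" if "u \<in> A" "v \<in> A" "w \<in> A" for u v w
    using that by (simp add: mult_diff mult_left_comm[of w u v] mult_comm[of w v])
  have term0: "q (g (?c k) \<odot> ?u - ?P k) = 0" for k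
  proof -
    have "?u = (e - emb (?c k) \<odot> a) \<odot> ?P k"
      by (subst geometric_sum) (simp_all only: pow_emb_mult c a mult_closed emb_closed)
    then have "g (?c k) \<odot> ?u - ?P k = ?P k \<odot> (g (?c k) \<odot> (e - emb (?c k) \<odot> a) - e)"
      by (simp only: aux[of "g (?c k)" "e - emb (?c k) \<odot> a" "?P k"] a g diff_closed one_closed
          mult_closed emb_closed sum_closed pow_closed)
    then show ?thesis using q_mult_zero[of "?P k"] res by simp
  qed
  \<comment> \<open>After exchanging the sums, the coefficient of \<open>pow a m\<close> contains
    the sum of the \<open>m\<close>-th powers of the roots of unity, which is 0 unless
    \<open>m = 0\<close>.\<close>
  have "(\<Sum>k<n. ?P k) = (\<Sum>m<n. \<Sum>k<n. emb (?c k ^ m) \<odot> pow a m)"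
    by (subst sum.swap) (simp add: pow_emb_mult)
  also have "\<dots> = (\<Sum>m<n. emb (of_real r ^ m * (\<Sum>k<n. (cis (2 * pi / n) ^ k) ^ m)) \<odot> pow a m)"
    by (simp add: emb_sum sum_mult sum_distrib_left power_mult_distrib mult.commute)
  also have "\<dots> = (\<Sum>m<n. if m = 0 then emb (of_nat n) else 0)"
    using n by (intro sum.cong refl) (simp add: sum_powers_root_of_unity)
  also have "\<dots> = emb (of_nat n)" using n by simp
  finally have P: "(\<Sum>k<n. ?P k) = emb (of_nat n)" .
  have en: "emb (1 / of_nat n) \<odot> emb (of_nat n) = e"
    using n by (simp add: emb_mult[symmetric] emb_1)
  have "circle_mean n r \<odot> ?u - e = emb (1 / of_nat n) \<odot> (\<Sum>k<n. g (?c k) \<odot> ?u - ?P k)"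
    by (simp add: circle_mean_def mult_assoc sum_mult sum_subtractf P mult_diff en)
  moreover have "q (\<Sum>k<n. g (?c k) \<odot> ?u - ?P k) \<le> (\<Sum>k<n. q (g (?c k) \<odot> ?u - ?P k))"
    by (rule q_sum) simp
  then have "q (\<Sum>k<n. g (?c k) \<odot> ?u - ?P k) = 0"
    using term0 by (intro antisym) auto
  ultimately show ?thesis
    by (simp add: q_emb_eq)
qed

text \<open>Since the bound on \<open>s - r\<close> is uniform on \<open>[0, R]\<close>, iterating this step takes the decay of
  \<open>r ^ n * q (pow a n)\<close> from \<open>r = 0\<close> to arbitrary \<open>r\<close>.\<close>
lemma decay_step:
  assumes B: "\<forall>c\<in>cball 0 R. q (g c) \<le> B"
    and rs: "0 \<le> r" "r \<le> s" "s \<le> R" "q a * B * B * (s - r) \<le> 1 / 6"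
    and lim: "(\<lambda>n. r ^ n * q (pow a n)) \<longlonglongrightarrow> 0"
  shows "\<forall>\<^sub>F n in sequentially. s ^ n * q (pow a n) \<le> 1 / 2"
proof -
  note [simp] = a g
  have "(\<lambda>n. B * (r ^ n * q (pow a n))) \<longlonglongrightarrow> B * 0"
    by (intro tendsto_intros lim)
  then have "\<forall>\<^sub>F n in sequentially. B * (r ^ n * q (pow a n)) < 1 / 6"
    by (rule order_tendstoD) simp
  then show ?thesis
    using eventually_gt_at_top[of 0]
  proof eventually_elim
    case (elim n)
    define c where "c t = emb (of_real t ^ n) \<odot> pow a n" for t
    have c [simp]: "c t \<in> A" for t by (simp add: c_def)
    have qc: "q (c t) = t ^ n * q (pow a n)" if "0 \<le> t" for t
      unfolding c_def using that by (subst q_emb_eq) (auto simp: norm_power)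
    have inv: "q (circle_mean n t \<odot> (e - c t) - e) = 0" for t
      unfolding c_def using circle_mean_inverse elim by blast
    \<comment> \<open>At radius \<open>r\<close> the mean is close to \<open>e\<close>, because
      \<open>c r\<close> is small; the Lipschitz bound then carries this closeness to radius
      \<open>s\<close>.\<close>
    have "q (circle_mean n r - e) = q (circle_mean n r \<odot> c r)"
      using inv[of r] by (intro q_perturb) (auto simp: mult_diff algebra_simps)
    also have "\<dots> \<le> q (circle_mean n r) * q (c r)" by (intro q_mult) auto
    also have "\<dots> \<le> B * q (c r)"
      using circle_mean_le[OF B] rs elim by (intro mult_right_mono) auto
    finally have 1: "q (circle_mean n r - e) \<le> 1 / 6" using elim qc rs by simp
    have "q (circle_mean n s - circle_mean n r) \<le> q a * B * B * \<bar>s - r\<bar>"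
      using rs elim by (intro circle_mean_diff_le[OF B]) auto
    then have 2: "q (circle_mean n s - circle_mean n r) \<le> 1 / 6" using rs by simp
    have "q (circle_mean n s - e)
        \<le> q (circle_mean n s - circle_mean n r) + q (circle_mean n r - e)"
      using q_add[of "circle_mean n s - circle_mean n r" "circle_mean n r - e"] by simp
    then have 3: "q (circle_mean n s - e) \<le> 1 / 3" using 1 2 by simp
    let ?d = "circle_mean n s - e"
    \<comment> \<open>Modulo the kernel of \<open>q\<close>, \<open>c s\<close> equals
      \<open>?d - c s \<odot> ?d\<close>. As \<open>q ?d \<le> 1 / 3\<close>, this gives
      \<open>q (c s) \<le> 1 / 3 + q (c s) / 3\<close>, that is, at most 1/2.\<close>
    have "q (c s) = q (?d - c s \<odot> ?d)"
    proof (rule sym, rule q_perturb)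
      have "?d - c s \<odot> ?d - c s = circle_mean n s \<odot> (e - c s) - e"
        by (simp add: ring_rules)
      then show "q (?d - c s \<odot> ?d - c s) = 0" using inv[of s] by (simp only:)
    qed auto
    also have "\<dots> \<le> q ?d + q (c s \<odot> ?d)" by (intro q_diff) auto
    also have "\<dots> \<le> q ?d + q (c s) * q ?d" by (intro add_left_mono q_mult) auto
    also have "\<dots> \<le> 1 / 3 + q (c s) * (1 / 3)" using 3 by (intro add_mono mult_left_mono) auto
    finally show ?case using qc[of s] rs by simp
  qed
qed

text \<open>Decay is propagated from radius 0 to radius \<open>t\<close> along the grid of multiples
  of \<open>t / k\<close>.\<close>

lemma resolvent_everywhere_imp_decay:
  assumes t: "t > 0"
  shows "(\<lambda>n. t ^ n * q (pow a n)) \<longlonglongrightarrow> 0"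
proof -
  \<comment> \<open>The disc must reach beyond \<open>t\<close>, since the step from grid point
    \<open>j\<close> looks ahead to radius \<open>(j + 2) * t / k\<close>.\<close>
  obtain B where B: "B \<ge> 0" "\<forall>c\<in>cball 0 (3 * t). q (g c) \<le> B"
    using resolvent_bounded by blast
  \<comment> \<open>So fine a grid that an advance by \<open>2 * t / k\<close> moves the means by at
    most 1/6.\<close>
  obtain k :: nat where k: "real k > max 1 (12 * t * (q a * B * B))"
    using reals_Archimedean2 by blast
  then have k0: "k > 0" by (intro gr0I) auto
  have small: "q a * B * B * (2 * t / k) \<le> 1 / 6"
    using k k0 by (simp add: field_simps)
  have "(\<lambda>n. (j * t / k) ^ n * q (pow a n)) \<longlonglongrightarrow> 0" if "j \<le> k" for j :: nat
    using that
  proof (induction j)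
    case 0
    show ?case
      by (rule tendsto_eventually) (auto simp: eventually_sequentially intro!: exI[of _ 1])
  next
    case (Suc j)
    \<comment> \<open>The decay step yields only the bound 1/2, so it is applied two grid points
      ahead, at \<open>s\<close>. Convergence to 0 is recovered at the intermediate point
      \<open>w\<close>, because \<open>(w / s) ^ n\<close> tends to 0.\<close>
    define r s w where "r = real j * t / k" and "s = (real j + 2) * t / k"
      and "w = real (Suc j) * t / k"
    have rws: "0 \<le> r" "r \<le> s" "0 < w" "w < s"
      using t k0 by (auto simp: r_def s_def w_def field_simps intro: add_pos_nonneg)
    have "(real j + 2) * t \<le> (3 * real k) * t"
      using Suc.prems t k0 by (intro mult_right_mono) linarith+
    then have "s \<le> 3 * t"
      using k0 by (simp add: s_def divide_le_eq mult_ac)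
    moreover have "s - r = 2 * t / k" by (simp add: r_def s_def diff_divide_distrib[symmetric] left_diff_distrib[symmetric])
    ultimately have ev: "\<forall>\<^sub>F n in sequentially. s ^ n * q (pow a n) \<le> 1 / 2"
      using Suc rws small by (intro decay_step[OF B(2), of r]) (auto simp: r_def)
    have "(\<lambda>n. (w / s) ^ n * (1 / 2)) \<longlonglongrightarrow> 0 * (1 / 2)"
      using rws by (intro tendsto_mult LIMSEQ_realpow_zero tendsto_const) auto
    then have lim: "(\<lambda>n. (w / s) ^ n * (1 / 2)) \<longlonglongrightarrow> 0" by simp
    have "(\<lambda>n. w ^ n * q (pow a n)) \<longlonglongrightarrow> 0"
    proof (rule tendsto_sandwich[OF _ _ tendsto_const lim])
      show "\<forall>\<^sub>F n in sequentially. w ^ n * q (pow a n) \<le> (w / s) ^ n * (1 / 2)"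
        using ev
      proof eventually_elim
        case (elim n)
        have "w ^ n * q (pow a n) = (w / s) ^ n * (s ^ n * q (pow a n))"
          using rws by (simp add: power_divide)
        also have "\<dots> \<le> (w / s) ^ n * (1 / 2)"
          using elim rws by (intro mult_left_mono) auto
        finally show ?case .
      qed
    qed (use rws in auto)
    then show ?case by (simp add: w_def)
  qed
  from this[of k] show ?thesis using k0 by simp
qed

end

theorem gelfand_mazur:
  assumes a: "a \<in> A"
  shows "\<exists>c. q (a - emb c) = 0"
proof (rule ccontr)
  assume "\<not> ?thesis"
  then have ne: "q (a - emb c) \<noteq> 0" for c by blast
  have "\<exists>v. v \<in> A \<and> q (v \<odot> (e - emb c \<odot> a) - e) = 0" for c
  proof (cases "c = 0")
    case True
    then show ?thesis using a by (intro exI[of _ e]) auto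
  next
    case False
    obtain v where v: "v \<in> A" "q (v \<odot> (a - emb (1 / c)) - e) = 0"
      using inverse_ex[of "a - emb (1 / c)"] ne a by auto
    have e: "emb (1 / c) \<odot> emb c = e" "\<And>u. u \<in> A \<Longrightarrow> emb (1 / c) \<odot> (emb c \<odot> u) = u"
      using False by (simp_all add: mult_assoc[symmetric] emb_mult[symmetric] emb_1)
    \<comment> \<open>Since \<open>e - c a = - c (a - 1 / c)\<close>, an inverse of
      \<open>a - emb (1 / c)\<close> multiplied by \<open>- 1 / c\<close> is the required
      resolvent.\<close>
    have "emb (1 / c) \<odot> (e - emb c \<odot> a) = - (a - emb (1 / c))"
      using a by (simp add: mult_diff e(2))
    then have "(- (emb (1 / c) \<odot> v)) \<odot> (e - emb c \<odot> a) = v \<odot> (a - emb (1 / c))"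
      using v a
      by (metis (no_types, lifting) diff_closed emb_closed minus_mult minus_minus mult_assoc
          mult_closed mult_comm mult_minus one_closed)
    then show ?thesis using v a by (intro exI[of _ "- (emb (1 / c) \<odot> v)"]) auto
  qed
  then obtain g where g: "\<And>c. g c \<in> A" "\<And>c. q (g c \<odot> (e - emb c \<odot> a) - e) = 0"
    by metis
  \<comment> \<open>The case \<open>c = 0\<close> of the assumption makes \<open>a\<close> itself
    invertible, which bounds its powers from below.\<close>
  obtain h where h: "h \<in> A" "q (h \<odot> a - e) = 0"
    using inverse_ex[OF a] ne[of 0] by auto
  have step: "q (pow a n) \<le> q h * q (pow a (Suc n))" for n
  proof -
    have "q (pow a n \<odot> (h \<odot> a - e)) = 0" using h a by (intro q_mult_zero) auto
    moreover have "h \<odot> pow a (Suc n) - pow a n = pow a n \<odot> (h \<odot> a - e)"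
      using h a by (simp add: ring_rules)
    ultimately have "q (pow a n) = q (h \<odot> pow a (Suc n))"
      using h a by (intro q_perturb[symmetric]) (auto simp del: pow.simps)
    also have "\<dots> \<le> q h * q (pow a (Suc n))" using h a by (intro q_mult) (auto simp del: pow.simps)
    finally show ?thesis .
  qed
  have low: "q e \<le> q h ^ n * q (pow a n)" for n
  proof (induction n)
    case (Suc n)
    have "q h ^ n * q (pow a n) \<le> q h ^ n * (q h * q (pow a (Suc n)))"
      by (intro mult_left_mono step) auto
    then show ?case using Suc by (simp add: mult_ac)
  qed simp
  \<comment> \<open>The case \<open>n = 1\<close> makes \<open>q h\<close> positive, hence an
    admissible radius; decay at exactly this radius contradicts the lower bound
    \<open>low\<close>.\<close>
  have "q h \<noteq> 0" using low[of 1] q_one by auto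
  then have "q h > 0" using q_nonneg[of h] by linarith
  then have "(\<lambda>n. q h ^ n * q (pow a n)) \<longlonglongrightarrow> 0"
    by (rule resolvent_everywhere_imp_decay[OF a g])
  then have "q e \<le> 0" by (rule LIMSEQ_le_const) (use low in auto)
  then show False using q_one by simp
qed

end

section \<open>The open mapping theorem and closed subspaces\<close>

text \<open>The open mapping theorem, stated for a relation \<open>P t z\<close> saying that \<open>z\<close> has a preimage of
  norm at most \<open>t\<close>.\<close>
lemma open_mapping_gauge:
  fixes P :: "real \<Rightarrow> 'w :: banach \<Rightarrow> bool"
  assumes add: "\<And>s t u v. P s u \<Longrightarrow> P t v \<Longrightarrow> P (s + t) (u + v)"
    and scale: "\<And>c t z. P t z \<Longrightarrow> P (\<bar>c\<bar> * t) (c *\<^sub>R z)"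
    and mono: "\<And>s t z. P s z \<Longrightarrow> s \<le> t \<Longrightarrow> P t z"
    and sums: "\<And>t z s w. (\<And>n::nat. P (t n) (z n)) \<Longrightarrow> t sums s \<Longrightarrow> z sums w \<Longrightarrow> P s w"
    and surj: "\<And>z. \<exists>t. P t z"
  shows "\<exists>C>0. \<forall>z. P (C * norm z) z"
proof -
  define S where "S n = {z. P (real n) z}" for n :: nat
  have "z \<in> (\<Union>n. S n)" for z
  proof -
    obtain t where "P t z" using surj by blast
    moreover obtain n :: nat where "t \<le> n" using real_arch_simple by blast
    ultimately show ?thesis using mono by (auto simp: S_def)
  qed
  then have UN: "(\<Union>n. closure (S n)) = UNIV" using closure_subset by fastforce
  have "\<exists>n. interior (closure (S n)) \<noteq> {}"
  proof (rule ccontr)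
    assume "\<not> ?thesis"
    then have "(euclidean :: 'w topology) interior_of \<Union> (range (\<lambda>n. closure (S n))) = {}"
      by (intro Baire_category_alt) (auto simp: completely_metrizable_space_euclidean)
    then show False using UN by simp
  qed
  then obtain n z0 r where r: "r > 0" "ball z0 r \<subseteq> closure (S n)"
    by (metis all_not_in_conv mem_interior)
  have approx_ball: "\<exists>w. P (2 * real n) w \<and> norm (y - w) < \<epsilon>"
    if y: "norm y < r" "\<epsilon> > 0" for y \<epsilon>
  proof -
    \<comment> \<open>The ball is moved to the origin: \<open>y\<close> is the difference of
      \<open>z0 + y\<close> and \<open>z0\<close>, both approximable at cost \<open>n\<close>,
      whence the cost \<open>2 * n\<close>.\<close>
    have "z0 + y \<in> closure (S n)" "z0 \<in> closure (S n)"
      using r y by (auto simp: dist_norm)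
    then obtain u v where u: "u \<in> S n" "dist u (z0 + y) < \<epsilon> / 2"
      and v: "v \<in> S n" "dist v z0 < \<epsilon> / 2"
      using y(2) by (meson closure_approachable half_gt_zero)
    have "P (real n + \<bar>- 1\<bar> * real n) (u + (- 1) *\<^sub>R v)"
      using u v by (intro add scale) (auto simp: S_def)
    moreover have "norm (y - (u - v)) = norm ((v - z0) - (u - (z0 + y)))"
      by (simp add: algebra_simps)
    then have "norm (y - (u - v)) < \<epsilon>"
      using norm_triangle_ineq4[of "v - z0" "u - (z0 + y)"] u v by (simp add: dist_norm)
    ultimately show ?thesis by (intro exI[of _ "u - v"]) simp
  qed
  \<comment> \<open>Rescaling \<open>y\<close> to norm \<open>r / 2\<close> and back multiplies the
    cost \<open>2 * n\<close> by \<open>2 * norm y / r\<close>.\<close>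
  define D where "D = 4 * real n / r"
  have D: "D \<ge> 0" using r by (simp add: D_def)
  have approx: "\<exists>w. P (D * norm y) w \<and> norm (y - w) \<le> norm y / 2" for y
  proof (cases "y = 0")
    case True
    obtain t where "P t (0 :: 'w)" using surj by blast
    from scale[OF this, of 0] show ?thesis using True by (intro exI[of _ 0]) simp
  next
    case False
    define k where "k = r / (2 * norm y)"
    have k: "k > 0" using False r by (simp add: k_def)
    have "norm (k *\<^sub>R y) < r" using False r by (simp add: k_def)
    then obtain w where w: "P (2 * real n) w" "norm (k *\<^sub>R y - w) < k * (norm y / 2)"
      using approx_ball[of "k *\<^sub>R y" "k * (norm y / 2)"] False k by auto
    have "norm (y - (1 / k) *\<^sub>R w) = norm ((1 / k) *\<^sub>R (k *\<^sub>R y - w))"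
      using k by (simp add: scaleR_diff_right)
    also have "\<dots> = norm (k *\<^sub>R y - w) / k" using k by simp
    also have "\<dots> \<le> norm y / 2" using w(2) k by (simp add: field_simps)
    finally have "norm (y - (1 / k) *\<^sub>R w) \<le> norm y / 2" .
    moreover have "P (D * norm y) ((1 / k) *\<^sub>R w)"
      using scale[OF w(1), of "1 / k"] k r False by (simp add: D_def k_def mult_ac)
    ultimately show ?thesis by blast
  qed
  then obtain f where f: "\<And>y. P (D * norm y) (f y)" "\<And>y. norm (y - f y) \<le> norm y / 2"
    by metis
  have main: "P (2 * D * norm z) z" for z
  proof -
    \<comment> \<open>\<open>y n\<close> is the remainder after \<open>n\<close> approximations. It
      halves at each stage, so the approximants \<open>f (y n)\<close> sum to \<open>z\<close> at
      total cost \<open>2 * D * norm z\<close>.\<close>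
    define y where "y n = ((\<lambda>y. y - f y) ^^ n) z" for n
    have y0: "y 0 = z" and ySuc: "y (Suc n) = y n - f (y n)" for n
      by (auto simp: y_def)
    have ny: "norm (y n) \<le> norm z * (1 / 2) ^ n" for n
    proof (induction n)
      case (Suc n)
      then show ?case using f(2)[of "y n"] by (simp add: ySuc)
    qed (simp add: y0)
    have "(\<lambda>n. norm z * (1 / 2) ^ n) \<longlonglongrightarrow> norm z * 0"
      by (intro tendsto_intros LIMSEQ_power_zero) simp
    then have lim: "(\<lambda>n. norm z * (1 / 2) ^ n) \<longlonglongrightarrow> 0" by simp
    have "(\<lambda>n. norm (y n)) \<longlonglongrightarrow> 0"
      by (rule tendsto_sandwich[OF _ _ tendsto_const lim]) (auto intro!: always_eventually ny)
    then have "y \<longlonglongrightarrow> 0" by (rule tendsto_norm_zero_cancel)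
    then have "(\<lambda>n. z - y n) \<longlonglongrightarrow> z" using tendsto_diff[OF tendsto_const, of y 0 _ z] by simp
    moreover have "(\<Sum>k<n. f (y k)) = z - y n" for n
      by (induction n) (auto simp: y0 ySuc)
    ultimately have "(\<lambda>n. f (y n)) sums z" by (simp add: sums_def)
    moreover have "P (D * norm z * (1 / 2) ^ n) (f (y n))" for n
      using f(1)[of "y n"] mult_left_mono[OF ny[of n] D] by (auto intro: mono simp: mult_ac)
    moreover have "(\<lambda>n. D * norm z * (1 / 2) ^ n) sums (D * norm z * 2)"
      using sums_mult[OF geometric_sums[of "1 / 2 :: real"]] by simp
    ultimately show ?thesis using sums[of "\<lambda>n. D * norm z * (1 / 2) ^ n" "\<lambda>n. f (y n)"]
      by (simp add: mult_ac)
  qed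
  \<comment> \<open>Adding 1 makes the constant positive even when \<open>D = 0\<close>.\<close>
  show ?thesis
  proof (intro exI[of _ "2 * D + 1"] conjI allI)
    show "P ((2 * D + 1) * norm z) z" for z
      using mono[OF main] by (simp add: distrib_right)
  qed (use D in auto)
qed

section \<open>Strongly closed sets and closed complex subspaces\<close>

lemma strong_operator_closed_limit:
  assumes "closedin strong_operator_topology A" "\<And>n::nat. f n \<in> A"
    and lim: "\<And>z. (\<lambda>n. blinfun_apply (f n) z) \<longlonglongrightarrow> blinfun_apply b z"
  shows "b \<in> A"
proof (rule limitin_closedin)
  have limf: "limitin euclidean (\<lambda>n. blinfun_apply (f n)) (blinfun_apply b) sequentially"
    using lim by (subst euclidean_product_topology[symmetric]) (simp add: limitin_componentwise)
  show "limitin strong_operator_topology f b sequentially"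
    unfolding limitin_def
  proof (intro conjI allI impI)
    fix U assume "openin strong_operator_topology U \<and> b \<in> U"
    then obtain V where "openin euclidean V" "U = blinfun_apply -` V" "blinfun_apply b \<in> V"
      by (auto simp: strong_operator_topology_def openin_pullback_topology)
    then show "\<forall>\<^sub>F n in sequentially. f n \<in> U" using limf by (auto simp: limitin_def)
  qed (simp add: strong_operator_topology_topspace)
qed (use assms in auto)

lemma strong_operator_closed_imp_closed:
  assumes "closedin strong_operator_topology A"
  shows "closed A"
  using closedin_continuous_map_preimage[OF strong_operator_topology_weaker_than_euclidean assms]
  by simp

lemma scaleC_one: "1 *\<^sub>C (x :: 'a :: complex_normed_vector) = x"
  using scaleC_of_real[of 1 x] by simp

lemma scaleC_diff_right: "c *\<^sub>C (x - y) = c *\<^sub>C x - c *\<^sub>C (y :: 'a :: complex_normed_vector)"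
  by (rule linear_diff[OF bounded_linear.linear[OF bounded_linear_scaleC]])

lemma csubspace_uminus: "csubspace K \<Longrightarrow> u \<in> K \<Longrightarrow> - u \<in> K"
  unfolding csubspace_def by (metis scaleC_minus1)

lemma csubspace_diff: "csubspace K \<Longrightarrow> u \<in> K \<Longrightarrow> v \<in> K \<Longrightarrow> u - v \<in> K"
  using csubspace_uminus[of K v] unfolding csubspace_def by (metis diff_conv_add_uminus)

lemma csubspace_closure:
  assumes "csubspace K" shows "csubspace (closure K)"
  unfolding csubspace_def
proof (intro conjI ballI allI)
  show "0 \<in> closure K" using assms closure_subset by (auto simp: csubspace_def)
next
  fix u v assume "u \<in> closure K" "v \<in> closure K"
  then obtain f g where "\<And>n. f n \<in> K" "f \<longlonglongrightarrow> u" "\<And>n. g n \<in> K" "g \<longlonglongrightarrow> v"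
    by (metis closure_sequential)
  then show "u + v \<in> closure K"
    using assms unfolding closure_sequential csubspace_def
    by (intro exI[of _ "\<lambda>n. f n + g n"]) (auto intro: tendsto_add)
next
  fix c u assume "u \<in> closure K"
  then obtain f where "\<And>n. f n \<in> K" "f \<longlonglongrightarrow> u" by (metis closure_sequential)
  then show "c *\<^sub>C u \<in> closure K"
    using assms unfolding closure_sequential csubspace_def
    by (intro exI[of _ "\<lambda>n. c *\<^sub>C f n"]) (auto intro: bounded_linear.tendsto[OF bounded_linear_scaleC])
qed

lemma image_closure_blinfun:
  assumes "blinfun_apply a ` K \<subseteq> K" shows "blinfun_apply a ` closure K \<subseteq> closure K"
proof (rule image_closure_subset)
  show "continuous_on (closure K) (blinfun_apply a)"
    by (intro linear_continuous_on blinfun.bounded_linear_right)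
qed (use assms closure_subset in auto)

text \<open>For passing to the infimum over \<open>S\<close> in product estimates, one factor at a
  time.\<close>

lemma le_mult_infdist:
  assumes "S \<noteq> {}" "0 \<le> k" "\<And>s. s \<in> S \<Longrightarrow> c \<le> k * dist v s"
  shows "c \<le> k * infdist v S"
proof (cases "k = 0")
  case True
  then show ?thesis using assms by auto
next
  case False
  then have "c / k \<le> dist v s" if "s \<in> S" for s
    using assms(2) assms(3)[OF that] by (simp add: field_simps)
  then have "c / k \<le> infdist v S"
    using assms(1) by (auto simp: infdist_notempty intro: cINF_greatest)
  then show ?thesis using False assms(2) by (simp add: field_simps)
qed

section \<open>Maximal ideals\<close>

locale operator_algebra =
  fixes A :: "('a :: complex_banach \<Rightarrow>\<^sub>L 'a) set"
  assumes alg: "abelian_unital_subalgebra A" and strong_closed: "closedin strong_operator_topology A"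
begin

lemma zero_A: "0 \<in> A" and id_A: "id_blinfun \<in> A"
  and add_A: "\<And>a b. a \<in> A \<Longrightarrow> b \<in> A \<Longrightarrow> a + b \<in> A"
  and uminus_A: "\<And>a. a \<in> A \<Longrightarrow> - a \<in> A"
  and comp_A: "\<And>a b. a \<in> A \<Longrightarrow> b \<in> A \<Longrightarrow> a o\<^sub>L b \<in> A"
  and comm_A: "\<And>a b. a \<in> A \<Longrightarrow> b \<in> A \<Longrightarrow> a o\<^sub>L b = b o\<^sub>L a"
  by (rule abelian_unital_subalgebraD[OF alg]; assumption)+

lemma csubspace_A: "csubspace A"
  using alg by (simp add: abelian_unital_subalgebra_def)

lemma scaleC_A: "a \<in> A \<Longrightarrow> c *\<^sub>C a \<in> A"
  using csubspace_A by (simp add: csubspace_def)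

lemma diff_A: "a \<in> A \<Longrightarrow> b \<in> A \<Longrightarrow> a - b \<in> A"
  by (rule csubspace_diff[OF csubspace_A])

lemma closed_A: "closed A"
  by (rule strong_operator_closed_imp_closed[OF strong_closed])

lemma apply_scaleC: "a \<in> A \<Longrightarrow> blinfun_apply a (c *\<^sub>C z) = c *\<^sub>C blinfun_apply a z"
  using alg by (auto simp: abelian_unital_subalgebra_def bounded_ops_def)

lemma apply_comm: "a \<in> A \<Longrightarrow> b \<in> A \<Longrightarrow> blinfun_apply a (blinfun_apply b z) = blinfun_apply b (blinfun_apply a z)"
  by (metis comm_A blinfun_apply_blinfun_compose)

lemmas bilin = bounded_bilinear.add_left[OF bounded_bilinear_blinfun_compose]
  bounded_bilinear.add_right[OF bounded_bilinear_blinfun_compose]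
  bounded_bilinear.diff_left[OF bounded_bilinear_blinfun_compose]
  bounded_bilinear.diff_right[OF bounded_bilinear_blinfun_compose]

lemma comp_id [simp]: "a o\<^sub>L id_blinfun = a" "id_blinfun o\<^sub>L a = a"
  by (auto intro: blinfun_eqI)

lemma comp_assoc: "(a o\<^sub>L b) o\<^sub>L c = a o\<^sub>L (b o\<^sub>L c)"
  by (rule blinfun_eqI) simp

lemma scaleC_comp: "c *\<^sub>C a = (c *\<^sub>C id_blinfun) o\<^sub>L a" for a :: "'a \<Rightarrow>\<^sub>L 'a"
  by (rule blinfun_eqI) (simp add: scaleC_blinfun.rep_eq)

end

text \<open>Working with the preimage \<open>J\<close> in \<open>A\<close> turns statements about
  cosets into statements about operators.\<close>

locale maximal_preimage = operator_algebra A for A :: "('a :: complex_banach \<Rightarrow>\<^sub>L 'a) set" +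
  fixes y :: 'a and M :: "('a \<Rightarrow>\<^sub>L 'a) set set" and J :: "('a \<Rightarrow>\<^sub>L 'a) set"
  assumes maximal: "maximalideal M (quot_ring A y)"
    and J_eq: "J = {a \<in> A. quot_map A y a \<in> M}"
begin

lemma ring_hom: "ring_hom_ring (op_ring A) (quot_ring A y) (quot_map A y)"
  by (rule ideal.rcos_ring_hom_ring[OF ideal_annih[OF alg]])

lemma cring_quot: "cring (quot_ring A y)"
  by (rule ideal.quotient_is_cring[OF ideal_annih[OF alg] cring_op_ring[OF alg]])

lemma ideal_J: "ideal J (op_ring A)"
  using ring_hom_ring.ideal_vimage[OF ring_hom maximalideal.axioms(1)[OF maximal]]
  by (simp add: J_eq op_ring_def)

lemma J_sub: "J \<subseteq> A" by (auto simp: J_eq)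

lemma J_zero: "0 \<in> J"
  using additive_subgroup.zero_closed[OF ideal.axioms(1)[OF ideal_J]] by (simp add: op_ring_def)

lemma J_add: "a \<in> J \<Longrightarrow> b \<in> J \<Longrightarrow> a + b \<in> J"
  using additive_subgroup.a_closed[OF ideal.axioms(1)[OF ideal_J], of a b] by (simp add: op_ring_def)

lemma J_comp: "a \<in> A \<Longrightarrow> b \<in> J \<Longrightarrow> a o\<^sub>L b \<in> J"
  using ideal.I_l_closed[OF ideal_J, of b a] by (simp add: op_ring_def)

lemma csubspace_J: "csubspace J"
  unfolding csubspace_def
proof (intro conjI ballI allI J_zero J_add)
  show "c *\<^sub>C a \<in> J" if "a \<in> J" for c a
    by (subst scaleC_comp) (intro J_comp scaleC_A id_A that)
qed

lemmas J_diff = csubspace_diff[OF csubspace_J]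

lemma annih_sub_J: "annih A y \<subseteq> J"
proof
  fix a assume a: "a \<in> annih A y"
  then have "quot_map A y a = quot_map A y 0"
    using quot_map_eqI[OF alg, of a 0 y] zero_A by (auto simp: annih_def)
  then show "a \<in> J" using J_zero a by (auto simp: J_eq annih_def)
qed

lemma id_notin_J: "id_blinfun \<notin> J"
proof
  assume "id_blinfun \<in> J"
  then have "\<one>\<^bsub>quot_ring A y\<^esub> \<in> M"
    using ring_hom_ring.homh[OF ring_hom] ring_hom_one[of "quot_map A y" "op_ring A" "quot_ring A y"]
    by (simp add: J_eq op_ring_def)
  then have "M = carrier (quot_ring A y)"
    by (rule ideal.one_imp_carrier[OF maximalideal.axioms(1)[OF maximal]])
  then show False using maximalideal.I_notcarr[OF maximal] by simp
qed

text \<open>By maximality, \<open>M\<close> and the coset of \<open>a\<close> generate the whole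
  quotient ring. Writing its unit as a multiple of that coset plus an element of \<open>M\<close>
  and choosing representatives gives \<open>b\<close>.\<close>

lemma J_inverse:
  assumes a: "a \<in> A" "a \<notin> J"
  shows "\<exists>b\<in>A. (b o\<^sub>L a) - id_blinfun \<in> J"
proof -
  interpret Q: cring "quot_ring A y" by (rule cring_quot)
  interpret M: maximalideal M "quot_ring A y" by (rule maximal)
  interpret h: ring_hom_ring "op_ring A" "quot_ring A y" "quot_map A y" by (rule ring_hom)
  let ?h = "quot_map A y"
  let ?N = "PIdl\<^bsub>quot_ring A y\<^esub> (?h a) <+>\<^bsub>quot_ring A y\<^esub> M"
  have carr [simp]: "carrier (op_ring A) = A" by (simp add: op_ring_def)
  have ha: "?h a \<in> carrier (quot_ring A y)" using a by simp
  have PI: "ideal (PIdl\<^bsub>quot_ring A y\<^esub> (?h a)) (quot_ring A y)"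
    by (rule Q.cgenideal_ideal[OF ha])
  have N: "ideal ?N (quot_ring A y)"
    by (rule Q.add_ideals[OF PI M.is_ideal])
  have "M \<subseteq> ?N"
  proof
    fix m assume m: "m \<in> M"
    then have "m = \<zero>\<^bsub>quot_ring A y\<^esub> \<oplus>\<^bsub>quot_ring A y\<^esub> m" using M.Icarr by simp
    then show "m \<in> ?N"
      using m additive_subgroup.zero_closed[OF ideal.axioms(1)[OF PI]]
      unfolding set_add_def' by blast
  qed
  moreover have "?h a \<in> ?N"
  proof -
    have "?h a = ?h a \<oplus>\<^bsub>quot_ring A y\<^esub> \<zero>\<^bsub>quot_ring A y\<^esub>" using ha by simp
    then show ?thesis
      using Q.cgenideal_self[OF ha] M.zero_closed unfolding set_add_def' by blast
  qed
  moreover have "?h a \<notin> M" using a by (simp add: J_eq)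
  ultimately have "?N = carrier (quot_ring A y)"
    using M.I_maximal[OF N] ideal.Icarr[OF N] by blast
  then have "\<one>\<^bsub>quot_ring A y\<^esub> \<in> ?N" by simp
  then obtain u m where u: "u \<in> carrier (quot_ring A y)" and m: "m \<in> M"
    and one: "\<one>\<^bsub>quot_ring A y\<^esub> = u \<otimes>\<^bsub>quot_ring A y\<^esub> ?h a \<oplus>\<^bsub>quot_ring A y\<^esub> m"
    unfolding set_add_def' cgenideal_def by blast
  obtain b where b: "b \<in> A" "u = ?h b" using u by (auto simp: carrier_quot_ring)
  obtain c where c: "c \<in> A" "m = ?h c"
    using M.Icarr[OF m] by (auto simp: carrier_quot_ring)
  have "?h id_blinfun = \<one>\<^bsub>quot_ring A y\<^esub>"
    using h.hom_one by (simp add: op_ring_def)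
  also have "\<dots> = ?h ((b o\<^sub>L a) + c)"
  proof -
    have "?h b \<otimes>\<^bsub>quot_ring A y\<^esub> ?h a = ?h (b o\<^sub>L a)"
      using h.hom_mult[of b a] a b by (simp add: op_ring_def)
    moreover have "?h (b o\<^sub>L a) \<oplus>\<^bsub>quot_ring A y\<^esub> ?h c = ?h ((b o\<^sub>L a) + c)"
      using h.hom_add[of "b o\<^sub>L a" c] a b c by (simp add: op_ring_def comp_A)
    ultimately show ?thesis using one b c by simp
  qed
  finally have eq: "?h id_blinfun = ?h ((b o\<^sub>L a) + c)" .
  \<comment> \<open>Equal cosets have equal values at \<open>y\<close>, so the representatives
    differ by an element of the annihilator, which lies in \<open>J\<close>.\<close>
  have "{blinfun_apply id_blinfun y} = {blinfun_apply ((b o\<^sub>L a) + c) y}"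
    using arg_cong[OF eq, of "\<lambda>C. (\<lambda>d. blinfun_apply d y) ` C"] a b c
    by (simp only: eval_quot_map[OF alg] id_A add_A comp_A)
  then have "(b o\<^sub>L a) + c - id_blinfun \<in> annih A y"
    using a b c by (simp add: annih_def diff_A add_A comp_A id_A blinfun.diff_left)
  then have "(b o\<^sub>L a) + c - id_blinfun - c \<in> J"
    using annih_sub_J c m by (intro J_diff[of "(b o\<^sub>L a) + c - id_blinfun" c]) (auto simp: J_eq)
  then show ?thesis using b by (auto intro!: bexI[of _ b] simp: algebra_simps)
qed

text \<open>An \<open>m\<close> closer to the identity than 1 would be invertible in
  \<open>A\<close>, impossible in a proper ideal. The inverse is the fixed point of the contraction
  \<open>?f\<close> on the complete set \<open>A\<close>, in place of a Neumann series.\<close>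

lemma norm_id_diff_ge:
  assumes m: "m \<in> J" shows "norm (id_blinfun - m) \<ge> 1"
proof (rule ccontr)
  assume "\<not> ?thesis"
  then have lt: "norm (id_blinfun - m) < 1" by simp
  have mA: "m \<in> A" using m J_sub by blast
  let ?f = "\<lambda>b. id_blinfun + (b o\<^sub>L (id_blinfun - m))"
  have "\<exists>!b\<in>A. ?f b = b"
  proof (rule Banach_fix)
    show "complete A" using closed_A by (simp add: complete_eq_closed)
    show "A \<noteq> {}" using zero_A by blast
    show "?f ` A \<subseteq> A" using mA by (auto intro!: add_A comp_A diff_A id_A)
    show "dist (?f b) (?f c) \<le> norm (id_blinfun - m) * dist b c" for b c
      using norm_blinfun_compose[of "b - c" "id_blinfun - m"]
      by (simp add: dist_norm bilin(3)[symmetric] mult.commute)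
  qed (use lt in auto)
  then obtain b where b: "b \<in> A" "?f b = b" by blast
  then have "(b o\<^sub>L m) = id_blinfun" by (simp add: bilin algebra_simps)
  then show False using J_comp[OF b(1) m] id_notin_J by simp
qed

text \<open>If \<open>f n\<close> in \<open>J\<close> tends to some \<open>a\<close> outside
  \<open>J\<close>, let \<open>b\<close> invert \<open>a\<close> modulo \<open>J\<close>. Then
  \<open>b f n - (b a - 1)\<close> lies in \<open>J\<close> and tends to the identity, against the
  distance bound just shown.\<close>

lemma closed_J: "closed J"
proof -
  have "closure J \<subseteq> J"
  proof
    fix a assume a: "a \<in> closure J"
    then have aA: "a \<in> A" using closure_minimal[OF J_sub closed_A] by blast
    show "a \<in> J"
    proof (rule ccontr)
      assume "a \<notin> J"
      then obtain b where b: "b \<in> A" "(b o\<^sub>L a) - id_blinfun \<in> J" using J_inverse aA by blast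
      obtain f where f: "\<And>n. f n \<in> J" "f \<longlonglongrightarrow> a" using a by (metis closure_sequential)
      let ?g = "\<lambda>n. id_blinfun - ((b o\<^sub>L f n) - ((b o\<^sub>L a) - id_blinfun))"
      have "?g \<longlonglongrightarrow> id_blinfun - ((b o\<^sub>L a) - ((b o\<^sub>L a) - id_blinfun))"
        by (intro tendsto_intros bounded_bilinear.tendsto[OF bounded_bilinear_blinfun_compose] f)
      then have "?g \<longlonglongrightarrow> 0" by simp
      then have "(\<lambda>n. norm (?g n)) \<longlonglongrightarrow> 0" by (rule tendsto_norm_zero)
      moreover have "norm (?g n) \<ge> 1" for n
        by (rule norm_id_diff_ge[OF J_diff[OF J_comp[OF b(1) f(1)] b(2)]])
      ultimately have "(1 :: real) \<le> 0" by (intro LIMSEQ_le_const) auto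
      then show False by simp
    qed
  qed
  then show ?thesis by (simp add: closure_subset_eq)
qed

section \<open>The distance to \<open>J\<close> as the quotient norm of \<open>A / J\<close>\<close>

lemma infdist_J_add: "infdist (u + v) J \<le> infdist u J + infdist v J"
proof -
  have ne: "J \<noteq> {}" using J_zero by blast
  have "infdist (u + v) J - infdist v J \<le> 1 * infdist u J"
  proof (rule le_mult_infdist[OF ne])
    fix m assume m: "m \<in> J"
    have "infdist (u + v) J - dist u m \<le> 1 * infdist v J"
    proof (rule le_mult_infdist[OF ne])
      fix n assume n: "n \<in> J"
      have "infdist (u + v) J \<le> dist (u + v) (m + n)"
        by (rule infdist_le[OF J_add[OF m n]])
      also have "\<dots> \<le> dist u m + dist v n" by (rule dist_triangle_add)
      finally show "infdist (u + v) J - dist u m \<le> 1 * dist v n" by simp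
    qed simp
    then show "infdist (u + v) J - infdist v J \<le> 1 * dist u m" by simp
  qed simp
  then show ?thesis by simp
qed

text \<open>For \<open>m\<close> and \<open>n\<close> in \<open>J\<close> the difference of
  \<open>u v\<close> and \<open>(u - m) (v - n)\<close> lies in \<open>J\<close>; then the infimum
  is taken over \<open>n\<close> and \<open>m\<close> in turn.\<close>

lemma infdist_J_comp:
  assumes "u \<in> A" "v \<in> A"
  shows "infdist (u o\<^sub>L v) J \<le> infdist u J * infdist v J"
proof -
  have ne: "J \<noteq> {}" using J_zero by blast
  have "infdist (u o\<^sub>L v) J \<le> infdist v J * infdist u J"
  proof (rule le_mult_infdist[OF ne infdist_nonneg])
    fix m assume m: "m \<in> J"
    have "infdist (u o\<^sub>L v) J \<le> dist u m * infdist v J"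
    proof (rule le_mult_infdist[OF ne zero_le_dist])
      fix n assume n: "n \<in> J"
      have mA: "m \<in> A" "n \<in> A" using m n J_sub by auto
      \<comment> \<open>Commutativity brings the factor from \<open>J\<close> to the right, as
        \<open>J_comp\<close> requires.\<close>
      have "(u o\<^sub>L n) + ((m o\<^sub>L v) - (m o\<^sub>L n)) = (u o\<^sub>L n) + ((v o\<^sub>L m) - (n o\<^sub>L m))"
        using mA assms by (metis comm_A)
      also have "\<dots> \<in> J" using m n mA assms by (intro J_add J_diff J_comp)
      finally have "infdist (u o\<^sub>L v) J \<le> dist (u o\<^sub>L v) ((u o\<^sub>L n) + ((m o\<^sub>L v) - (m o\<^sub>L n)))"
        by (rule infdist_le)
      also have "\<dots> = norm ((u - m) o\<^sub>L (v - n))"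
        by (simp add: dist_norm bilin algebra_simps)
      also have "\<dots> \<le> dist u m * dist v n"
        using norm_blinfun_compose by (simp add: dist_norm)
      finally show "infdist (u o\<^sub>L v) J \<le> dist u m * dist v n" .
    qed
    then show "infdist (u o\<^sub>L v) J \<le> infdist v J * dist u m" by (simp add: mult.commute)
  qed
  then show ?thesis by (simp add: mult.commute)
qed

lemma infdist_J_scaleC: "infdist (c *\<^sub>C u) J \<le> cmod c * infdist u J"
proof (rule le_mult_infdist)
  fix m assume "m \<in> J"
  then have "c *\<^sub>C m \<in> J" using csubspace_J by (simp add: csubspace_def)
  then have "infdist (c *\<^sub>C u) J \<le> dist (c *\<^sub>C u) (c *\<^sub>C m)" by (rule infdist_le)
  also have "\<dots> = norm (c *\<^sub>C (u - m))"
    by (simp add: dist_norm scaleC_diff_right)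
  finally show "infdist (c *\<^sub>C u) J \<le> cmod c * dist u m" by (simp add: norm_scaleC dist_norm)
qed (use J_zero in auto)

lemma in_J_iff_infdist: "u \<in> J \<longleftrightarrow> infdist u J = 0"
  using in_closed_iff_infdist_zero[OF closed_J] J_zero by blast

text \<open>As \<open>J\<close> is closed, the distance to \<open>J\<close> vanishes exactly on
  \<open>J\<close>, and modulo \<open>J\<close> everything else is invertible, so Gelfand--Mazur
  applies to \<open>A / J\<close>.\<close>

lemma J_codim_1:
  assumes "a \<in> A" shows "\<exists>c. a - c *\<^sub>C id_blinfun \<in> J"
proof -
  interpret seminormed_quotient_field A "(o\<^sub>L)" id_blinfun "\<lambda>c. c *\<^sub>C id_blinfun" "\<lambda>u. infdist u J"
  proof
    show "infdist ((c *\<^sub>C id_blinfun) o\<^sub>L u) J \<le> cmod c * infdist u J" for c u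
      using infdist_J_scaleC[of c u] by (subst scaleC_comp[symmetric])
    show "(c * d) *\<^sub>C (id_blinfun :: 'a \<Rightarrow>\<^sub>L 'a) = (c *\<^sub>C id_blinfun) o\<^sub>L (d *\<^sub>C id_blinfun)"
      for c d
      using scaleC_comp[of c "d *\<^sub>C id_blinfun"] by (simp add: scaleC_scaleC)
    show "infdist id_blinfun J > 0"
      using id_notin_J in_J_iff_infdist infdist_nonneg[of id_blinfun J] by (simp add: less_le)
    show "\<exists>v\<in>A. infdist ((v o\<^sub>L u) - id_blinfun) J = 0" if "u \<in> A" "infdist u J \<noteq> 0" for u
      using J_inverse[of u] that in_J_iff_infdist by blast
  qed (auto simp: zero_A id_A add_A uminus_A comp_A scaleC_A comp_assoc bilin
      scaleC_one scaleC_add_left infdist_nonneg infdist_J_add infdist_J_comp intro: comm_A)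
  show ?thesis using gelfand_mazur[OF assms] in_J_iff_infdist by blast
qed

end

section \<open>Split strict multiplicity\<close>

lemma (in operator_algebra) closure_orbit_in_Lat: "closure (orbit_space A z) \<in> Lat A"
proof -
  have "csubspace (orbit_space A z)"
    unfolding csubspace_def
  proof (intro conjI ballI allI)
    show "0 \<in> orbit_space A z"
      unfolding orbit_space_def mem_Collect_eq by (intro exI[of _ 0]) (simp add: zero_A)
    show "u + v \<in> orbit_space A z" if "u \<in> orbit_space A z" "v \<in> orbit_space A z" for u v
      using that unfolding orbit_space_def mem_Collect_eq by (metis add_A blinfun.add_left)
    show "c *\<^sub>C u \<in> orbit_space A z" if "u \<in> orbit_space A z" for c u
      using that unfolding orbit_space_def mem_Collect_eq by (metis scaleC_A scaleC_blinfun.rep_eq)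
  qed
  moreover have "blinfun_apply a ` orbit_space A z \<subseteq> orbit_space A z" if "a \<in> A" for a
    using comp_A[OF that] by (force simp: orbit_space_def)
  ultimately show ?thesis
    by (simp add: Lat_def csubspace_closure image_closure_blinfun)
qed

lemma (in operator_algebra) algLat_in_closure_orbit:
  assumes "T \<in> algLat A" shows "blinfun_apply T z \<in> closure (orbit_space A z)"
proof -
  have "blinfun_apply id_blinfun z \<in> orbit_space A z"
    unfolding orbit_space_def using id_A by blast
  then show ?thesis
    using assms closure_orbit_in_Lat[of z] closure_subset[of "orbit_space A z"]
    by (auto simp: algLat_def)
qed

locale ssm_algebra = operator_algebra A for A :: "('a :: complex_banach \<Rightarrow>\<^sub>L 'a) set" +
  fixes p :: nat and x :: "nat \<Rightarrow> 'a"
  assumes realizes: "realizes_ssm A p x"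
begin

section \<open>Decompositions along the orbits, and their norm bounds\<close>

lemma decomposition_unique:
  assumes "\<And>i. i \<in> {1..p} \<Longrightarrow> a i \<in> A" "\<And>i. i \<in> {1..p} \<Longrightarrow> b i \<in> A"
    and eq: "(\<Sum>i=1..p. blinfun_apply (a i) (x i)) = (\<Sum>i=1..p. blinfun_apply (b i) (x i))"
    and j: "j \<in> {1..p}"
  shows "blinfun_apply (a j) (x j) = blinfun_apply (b j) (x j)"
proof -
  let ?y = "\<lambda>a. \<lambda>i\<in>{1..p}. blinfun_apply (a i) (x i)"
  have "?y a \<in> (\<Pi>\<^sub>E i\<in>{1..p}. orbit_space A (x i))" "?y b \<in> (\<Pi>\<^sub>E i\<in>{1..p}. orbit_space A (x i))"
    using assms(1,2) by (auto simp: orbit_space_def)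
  moreover have "(\<Sum>i=1..p. ?y a i) = (\<Sum>i=1..p. ?y b i)" using eq by simp
  moreover have "\<exists>!y. y \<in> (\<Pi>\<^sub>E i\<in>{1..p}. orbit_space A (x i)) \<and> (\<Sum>i=1..p. ?y a i) = (\<Sum>i=1..p. y i)"
    using realizes by (simp only: realizes_ssm_def internal_direct_sum_def)
  ultimately have "?y a = ?y b" by blast
  from fun_cong[OF this, of j] j show ?thesis by simp
qed

lemma decomposition_ex:
  "\<exists>a. (\<forall>i\<in>{1..p}. a i \<in> A) \<and> z = (\<Sum>i=1..p. blinfun_apply (a i) (x i))"
proof -
  obtain y where y: "y \<in> (\<Pi>\<^sub>E i\<in>{1..p}. orbit_space A (x i))" "z = (\<Sum>i=1..p. y i)"
    using realizes unfolding realizes_ssm_def internal_direct_sum_def by metis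
  then have "\<forall>i\<in>{1..p}. \<exists>a\<in>A. y i = blinfun_apply a (x i)"
    by (fastforce simp: orbit_space_def PiE_iff)
  then obtain a where "\<forall>i\<in>{1..p}. a i \<in> A \<and> y i = blinfun_apply (a i) (x i)" by metis
  then show ?thesis using y(2) by (intro exI[of _ a]) auto
qed

text \<open>The open mapping theorem for the map from \<open>p\<close>-tuples in \<open>A\<close> to
  the sum of the \<open>a i\<close> applied to \<open>x i\<close>, with the maximum norm on tuples.
  Only the existence of small coefficients is claimed; coefficients are determined only modulo
  annihilators.\<close>

lemma decomposition_bounded:
  "\<exists>C>0. \<forall>z. \<exists>a. (\<forall>i\<in>{1..p}. a i \<in> A \<and> norm (a i) \<le> C * norm z) \<and>
     z = (\<Sum>i=1..p. blinfun_apply (a i) (x i))"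
proof (rule open_mapping_gauge[where
    P = "\<lambda>t z. \<exists>a. (\<forall>i\<in>{1..p}. a i \<in> A \<and> norm (a i) \<le> t) \<and> z = (\<Sum>i=1..p. blinfun_apply (a i) (x i))"])
  fix s t :: real and u v
  assume "\<exists>a. (\<forall>i\<in>{1..p}. a i \<in> A \<and> norm (a i) \<le> s) \<and> u = (\<Sum>i=1..p. blinfun_apply (a i) (x i))"
    and "\<exists>a. (\<forall>i\<in>{1..p}. a i \<in> A \<and> norm (a i) \<le> t) \<and> v = (\<Sum>i=1..p. blinfun_apply (a i) (x i))"
  then obtain a b where "\<forall>i\<in>{1..p}. a i \<in> A \<and> norm (a i) \<le> s" "\<forall>i\<in>{1..p}. b i \<in> A \<and> norm (b i) \<le> t"
    "u = (\<Sum>i=1..p. blinfun_apply (a i) (x i))" "v = (\<Sum>i=1..p. blinfun_apply (b i) (x i))" by blast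
  then show "\<exists>a. (\<forall>i\<in>{1..p}. a i \<in> A \<and> norm (a i) \<le> s + t) \<and> u + v = (\<Sum>i=1..p. blinfun_apply (a i) (x i))"
    by (intro exI[of _ "\<lambda>i. a i + b i"])
       (auto simp: blinfun.add_left sum.distrib intro!: add_A norm_triangle_le add_mono)
next
  fix c t :: real and z
  assume "\<exists>a. (\<forall>i\<in>{1..p}. a i \<in> A \<and> norm (a i) \<le> t) \<and> z = (\<Sum>i=1..p. blinfun_apply (a i) (x i))"
  then obtain a where a: "\<forall>i\<in>{1..p}. a i \<in> A \<and> norm (a i) \<le> t"
    "z = (\<Sum>i=1..p. blinfun_apply (a i) (x i))" by blast
  have "c *\<^sub>R a i \<in> A" if "i \<in> {1..p}" for i
    using a that scaleC_A[of "a i" "of_real c"] by (simp add: scaleC_of_real)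
  then show "\<exists>a. (\<forall>i\<in>{1..p}. a i \<in> A \<and> norm (a i) \<le> \<bar>c\<bar> * t) \<and> c *\<^sub>R z = (\<Sum>i=1..p. blinfun_apply (a i) (x i))"
    using a by (intro exI[of _ "\<lambda>i. c *\<^sub>R a i"])
       (auto simp: blinfun.scaleR_left scaleR_sum_right intro!: mult_left_mono)
next
  fix t :: "nat \<Rightarrow> real" and z :: "nat \<Rightarrow> 'a" and s w
  assume "\<And>n. \<exists>a. (\<forall>i\<in>{1..p}. a i \<in> A \<and> norm (a i) \<le> t n) \<and> z n = (\<Sum>i=1..p. blinfun_apply (a i) (x i))"
    and t: "t sums s" and z: "z sums w"
  then obtain a where a: "\<And>n i. i \<in> {1..p} \<Longrightarrow> a n i \<in> A" "\<And>n i. i \<in> {1..p} \<Longrightarrow> norm (a n i) \<le> t n"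
    "\<And>n. z n = (\<Sum>i=1..p. blinfun_apply (a n i) (x i))" by metis
  \<comment> \<open>The coefficient series converge absolutely by comparison with \<open>t\<close>,
    and their sums stay in \<open>A\<close> because \<open>A\<close> is norm closed.\<close>
  define b where "b i = (\<Sum>n. a n i)" for i
  have b: "(\<lambda>n. a n i) sums b i" if "i \<in> {1..p}" for i
    unfolding b_def
    by (rule summable_sums, rule summable_comparison_test'[OF sums_summable[OF t]])
       (use a(2) that in blast)
  have "b i \<in> A" if i: "i \<in> {1..p}" for i
  proof (rule closed_sequentially[OF closed_A])
    show "(\<Sum>k<n. a k i) \<in> A" for n
      by (induction n) (use zero_A a(1) i add_A in auto)
    show "(\<lambda>n. \<Sum>k<n. a k i) \<longlonglongrightarrow> b i" using b[OF i] by (simp add: sums_def)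
  qed
  moreover have "norm (b i) \<le> s" if i: "i \<in> {1..p}" for i
  proof (rule LIMSEQ_le)
    show "(\<lambda>n. norm (\<Sum>k<n. a k i)) \<longlonglongrightarrow> norm (b i)"
      using b[OF i] by (intro tendsto_norm) (simp add: sums_def)
    show "(\<lambda>n. \<Sum>k<n. t k) \<longlonglongrightarrow> s" using t by (simp add: sums_def)
    show "\<exists>N. \<forall>n\<ge>N. norm (\<Sum>k<n. a k i) \<le> (\<Sum>k<n. t k)"
      using a(2)[OF i] by (auto intro!: sum_norm_le)
  qed
  moreover have "z sums (\<Sum>i=1..p. blinfun_apply (b i) (x i))"
    unfolding a(3)
    by (intro sums_sum bounded_linear.sums[OF blinfun.bounded_linear_left] b)
  then have "w = (\<Sum>i=1..p. blinfun_apply (b i) (x i))" using z sums_unique2 by blast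
  ultimately show "\<exists>a. (\<forall>i\<in>{1..p}. a i \<in> A \<and> norm (a i) \<le> s) \<and> w = (\<Sum>i=1..p. blinfun_apply (a i) (x i))"
    by blast
next
  fix z
  obtain a where a: "\<forall>i\<in>{1..p}. a i \<in> A" "z = (\<Sum>i=1..p. blinfun_apply (a i) (x i))"
    using decomposition_ex by blast
  moreover have "norm (a i) \<le> (\<Sum>i=1..p. norm (a i))" if "i \<in> {1..p}" for i
    using that by (intro member_le_sum) auto
  ultimately show "\<exists>t a. (\<forall>i\<in>{1..p}. a i \<in> A \<and> norm (a i) \<le> t) \<and> z = (\<Sum>i=1..p. blinfun_apply (a i) (x i))"
    by blast
next
  fix s t :: real and z
  assume "\<exists>a. (\<forall>i\<in>{1..p}. a i \<in> A \<and> norm (a i) \<le> s) \<and> z = (\<Sum>i=1..p. blinfun_apply (a i) (x i))"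
    and le: "s \<le> t"
  then obtain a where a: "\<And>i. i \<in> {1..p} \<Longrightarrow> a i \<in> A" "\<And>i. i \<in> {1..p} \<Longrightarrow> norm (a i) \<le> s"
    "z = (\<Sum>i=1..p. blinfun_apply (a i) (x i))" by blast
  then show "\<exists>a. (\<forall>i\<in>{1..p}. a i \<in> A \<and> norm (a i) \<le> t) \<and> z = (\<Sum>i=1..p. blinfun_apply (a i) (x i))"
    using order.trans[OF a(2) le] by blast
qed

lemma interpolating_element_ex:
  assumes T: "T \<in> algLat A"
  shows "\<exists>a\<in>A. \<forall>j\<in>{1..p}. blinfun_apply a (x j) = blinfun_apply T (x j)"
proof -
  obtain C where C: "C > 0" and dec: "\<And>z. \<exists>a. (\<forall>i\<in>{1..p}. a i \<in> A \<and> norm (a i) \<le> C * norm z) \<and>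
     z = (\<Sum>i=1..p. blinfun_apply (a i) (x i))"
    using decomposition_bounded by blast
  obtain c where c: "\<And>z i. i \<in> {1..p} \<Longrightarrow> c z i \<in> A" "\<And>z i. i \<in> {1..p} \<Longrightarrow> norm (c z i) \<le> C * norm z"
    "\<And>z. z = (\<Sum>i=1..p. blinfun_apply (c z i) (x i))"
    using dec by metis
  have "\<exists>b\<in>A. blinfun_apply T (x i) = blinfun_apply b (x i)" if "i \<in> {1..p}" for i
  proof -
    have "closed (orbit_space A (x i))" using realizes that by (simp add: realizes_ssm_def)
    then show ?thesis
      using algLat_in_closure_orbit[OF T, of "x i"] by (auto simp: orbit_space_def)
  qed
  then obtain b where b: "\<And>i. i \<in> {1..p} \<Longrightarrow> b i \<in> A"
    "\<And>i. i \<in> {1..p} \<Longrightarrow> blinfun_apply T (x i) = blinfun_apply (b i) (x i)" by metis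
  define z0 where "z0 = (\<Sum>i=1..p. x i)"
  obtain f where "\<And>n. f n \<in> orbit_space A z0" and flim: "f \<longlonglongrightarrow> blinfun_apply T z0"
    using algLat_in_closure_orbit[OF T, of z0] by (metis closure_sequential)
  then obtain a where a: "\<And>n. a n \<in> A" "\<And>n. f n = blinfun_apply (a n) z0"
    unfolding orbit_space_def mem_Collect_eq by metis
  have lim: "(\<lambda>n. blinfun_apply (a n) (x j)) \<longlonglongrightarrow> blinfun_apply T (x j)" if j: "j \<in> {1..p}" for j
  proof -
    define d where "d n = f n - blinfun_apply T z0" for n
    \<comment> \<open>The differences \<open>a n - b i\<close> are coefficients of the null sequence
      \<open>d\<close>. By uniqueness their values at \<open>x j\<close> agree with those of the
      bounded choice \<open>c (d n)\<close>, which tend to 0.\<close>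
    have "d n = (\<Sum>i=1..p. blinfun_apply (a n - b i) (x i))" for n
      by (simp add: d_def a z0_def blinfun.sum_right b(2) blinfun.diff_left sum_subtractf)
    then have eq: "blinfun_apply (a n - b j) (x j) = blinfun_apply (c (d n) j) (x j)" for n
      using c(3)[of "d n"] j a(1) b(1) c(1) by (intro decomposition_unique) (auto intro: diff_A)
    have "d \<longlonglongrightarrow> 0" using LIM_zero[OF flim] by (simp add: d_def[abs_def])
    then have "(\<lambda>n. C * norm (d n) * norm (x j)) \<longlonglongrightarrow> C * 0 * norm (x j)"
      by (intro tendsto_intros tendsto_norm_zero)
    then have "(\<lambda>n. C * norm (d n) * norm (x j)) \<longlonglongrightarrow> 0" by simp
    then have "(\<lambda>n. blinfun_apply (a n - b j) (x j)) \<longlonglongrightarrow> 0"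
    proof (rule Lim_null_comparison[rotated], intro always_eventually allI)
      fix n
      have "norm (blinfun_apply (c (d n) j) (x j)) \<le> norm (c (d n) j) * norm (x j)"
        by (rule norm_blinfun)
      also have "\<dots> \<le> C * norm (d n) * norm (x j)"
        using c(2)[OF j] by (intro mult_right_mono) auto
      finally show "norm (blinfun_apply (a n - b j) (x j)) \<le> C * norm (d n) * norm (x j)"
        by (simp add: eq)
    qed
    then show ?thesis
      using b(2)[OF j] by (simp add: blinfun.diff_left LIM_zero_iff)
  qed
  \<comment> \<open>The strong limit of \<open>a n\<close>: commutativity moves \<open>a n\<close>
    past the coefficients of \<open>z\<close> onto the vectors \<open>x i\<close>, where convergence
    is known. The choice \<open>c\<close> need not be linear in \<open>z\<close>; linearity of
    \<open>L\<close> comes from uniqueness of limits.\<close>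
  define L where "L z = (\<Sum>i=1..p. blinfun_apply (c z i) (blinfun_apply T (x i)))" for z
  have Llim: "(\<lambda>n. blinfun_apply (a n) z) \<longlonglongrightarrow> L z" for z
  proof -
    have "blinfun_apply (a n) z = (\<Sum>i=1..p. blinfun_apply (c z i) (blinfun_apply (a n) (x i)))" for n
    proof -
      have "blinfun_apply (a n) z = (\<Sum>i=1..p. blinfun_apply (a n) (blinfun_apply (c z i) (x i)))"
        by (subst c(3)[of z]) (simp add: blinfun.sum_right)
      also have "\<dots> = (\<Sum>i=1..p. blinfun_apply (c z i) (blinfun_apply (a n) (x i)))"
        using apply_comm a(1) c(1) by (intro sum.cong) auto
      finally show ?thesis .
    qed
    then show ?thesis unfolding L_def
      by (simp only:) (intro tendsto_sum blinfun.tendsto tendsto_const lim)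
  qed
  have "bounded_linear L"
  proof (rule bounded_linear_intro)
    show "L (u + v) = L u + L v" for u v
      by (rule LIMSEQ_unique[OF Llim]) (use tendsto_add[OF Llim Llim] in \<open>simp add: blinfun.add_right\<close>)
    show "L (r *\<^sub>R u) = r *\<^sub>R L u" for r u
      by (rule LIMSEQ_unique[OF Llim])
         (use tendsto_scaleR[OF tendsto_const Llim] in \<open>simp add: blinfun.scaleR_right\<close>)
    show "norm (L z) \<le> norm z * (\<Sum>i=1..p. C * norm (blinfun_apply T (x i)))" for z
      unfolding L_def sum_distrib_left
    proof (rule sum_norm_le)
      fix i assume i: "i \<in> {1..p}"
      have "norm (blinfun_apply (c z i) (blinfun_apply T (x i))) \<le> norm (c z i) * norm (blinfun_apply T (x i))"
        by (rule norm_blinfun)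
      also have "\<dots> \<le> (C * norm z) * norm (blinfun_apply T (x i))"
        using c(2)[OF i] by (intro mult_right_mono) auto
      finally show "norm (blinfun_apply (c z i) (blinfun_apply T (x i)))
          \<le> norm z * (C * norm (blinfun_apply T (x i)))" by (simp add: mult_ac)
    qed
  qed
  then have app: "blinfun_apply (Blinfun L) = L" by (rule bounded_linear_Blinfun_apply)
  have "Blinfun L \<in> A"
    by (rule strong_operator_closed_limit[OF strong_closed a(1)]) (use Llim in \<open>simp add: app\<close>)
  moreover have "L (x j) = blinfun_apply T (x j)" if "j \<in> {1..p}" for j
    by (rule LIMSEQ_unique[OF Llim lim[OF that]])
  ultimately show ?thesis using app by (intro bexI[of _ "Blinfun L"]) auto
qed

lemma component_in_maximal_ideal:
  assumes T: "T \<in> algLat A" and T0: "\<And>i. i \<in> {1..p} \<Longrightarrow> blinfun_apply T (x i) = 0"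
    and j: "j \<in> {1..p}" and M: "maximalideal M (quot_ring A (x j))"
    and b: "\<And>i. i \<in> {1..p} \<Longrightarrow> b i \<in> A" "blinfun_apply T z = (\<Sum>i=1..p. blinfun_apply (b i) (x i))"
  shows "quot_map A (x j) (b j) \<in> M"
proof -
  define J where "J = {a \<in> A. quot_map A (x j) a \<in> M}"
  interpret maximal_preimage A "x j" M J
    by (intro maximal_preimage.intro maximal_preimage_axioms.intro operator_algebra_axioms M J_def)
  \<comment> \<open>\<open>E\<close> sums up a family of coefficients, and \<open>K\<close> collects
    the vectors having some family whose \<open>j\<close>-th coefficient lies in
    \<open>J\<close>.\<close>
  define E where "E = (\<lambda>a :: nat \<Rightarrow> 'a \<Rightarrow>\<^sub>L 'a. \<Sum>i=1..p. blinfun_apply (a i) (x i))"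
  define F where "F = {a. (\<forall>i\<in>{1..p}. a i \<in> A) \<and> a j \<in> J}"
  define K where "K = E ` F"
  \<comment> \<open>Membership in \<open>K\<close> is independent of the chosen coefficients: two
    choices of the \<open>j\<close>-th one differ by an element of the annihilator, which is
    contained in \<open>J\<close>.\<close>
  have in_J: "a j \<in> J"
    if "\<And>i. i \<in> {1..p} \<Longrightarrow> a i \<in> A" "E a \<in> K" for a
  proof -
    obtain a' where a': "a' \<in> F" "E a = E a'" using \<open>E a \<in> K\<close> by (auto simp: K_def)
    then have "blinfun_apply (a j) (x j) = blinfun_apply (a' j) (x j)"
      using that j unfolding E_def F_def by (intro decomposition_unique) auto
    then have "a j - a' j \<in> annih A (x j)"
      using a' that j by (auto simp: annih_def F_def blinfun.diff_left intro: diff_A)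
    then have "a j - a' j + a' j \<in> J"
      using a' annih_sub_J by (intro J_add) (auto simp: F_def)
    then show ?thesis by simp
  qed
  have "K \<in> Lat A"
    unfolding Lat_def mem_Collect_eq
  proof (intro conjI ballI)
    show "csubspace K"
      unfolding csubspace_def
    proof (intro conjI ballI allI)
      have "E (\<lambda>_. 0) = 0" "(\<lambda>_. 0) \<in> F" using zero_A J_zero by (auto simp: E_def F_def)
      then show "0 \<in> K" unfolding K_def by (metis imageI)
    next
      fix u v assume "u \<in> K" "v \<in> K"
      then obtain a a' where "a \<in> F" "a' \<in> F" "u = E a" "v = E a'" by (auto simp: K_def)
      moreover have "E (\<lambda>i. a i + a' i) = E a + E a'"
        by (simp add: E_def blinfun.add_left sum.distrib)
      ultimately show "u + v \<in> K"
        unfolding K_def by (intro image_eqI[of _ _ "\<lambda>i. a i + a' i"]) (auto simp: F_def add_A J_add)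
    next
      fix c u assume "u \<in> K"
      then obtain a where a: "a \<in> F" "u = E a" by (auto simp: K_def)
      have "E (\<lambda>i. c *\<^sub>C a i) = c *\<^sub>C E a"
        by (simp add: E_def scaleC_blinfun.rep_eq linear_sum[OF bounded_linear.linear[OF bounded_linear_scaleC]])
      then show "c *\<^sub>C u \<in> K"
        using a csubspace_J unfolding K_def
        by (intro image_eqI[of _ _ "\<lambda>i. c *\<^sub>C a i"]) (auto simp: F_def scaleC_A csubspace_def)
    qed
    show "blinfun_apply d ` K \<subseteq> K" if d: "d \<in> A" for d
    proof
      fix u assume "u \<in> blinfun_apply d ` K"
      then obtain a where a: "a \<in> F" "u = blinfun_apply d (E a)" by (auto simp: K_def)
      then have "u = E (\<lambda>i. d o\<^sub>L a i)" by (simp add: E_def blinfun.sum_right)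
      then show "u \<in> K"
        using a d unfolding K_def
        by (intro image_eqI[of _ _ "\<lambda>i. d o\<^sub>L a i"]) (auto simp: F_def comp_A J_comp)
    qed
    show "closed K"
      unfolding closed_sequential_limits
    proof (intro allI impI, elim conjE)
      fix f l assume f: "\<forall>n. f n \<in> K" "f \<longlonglongrightarrow> l"
      obtain C where dec: "C > 0" "\<And>z. \<exists>a. (\<forall>i\<in>{1..p}. a i \<in> A \<and> norm (a i) \<le> C * norm z) \<and> z = E a"
        unfolding E_def using decomposition_bounded by blast
      obtain c where c: "\<And>z i. i \<in> {1..p} \<Longrightarrow> c z i \<in> A" "\<And>z i. i \<in> {1..p} \<Longrightarrow> norm (c z i) \<le> C * norm z"
        "\<And>z. z = E (c z)"
        using dec by metis
      \<comment> \<open>The coefficients of \<open>l\<close> are corrected by small coefficients of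
        \<open>f n - l\<close> to give coefficients of \<open>f n\<close>. The \<open>j\<close>-th
        ones lie in \<open>J\<close> and tend to \<open>c l j\<close>, so closedness of
        \<open>J\<close> suffices.\<close>
      define d where "d n = c (f n - l) j" for n
      have in_J': "c l j + d n \<in> J" for n
      proof -
        have "E (\<lambda>i. c l i + c (f n - l) i) = E (c l) + E (c (f n - l))"
          by (simp add: E_def blinfun.add_left sum.distrib)
        then have "E (\<lambda>i. c l i + c (f n - l) i) = f n" by (simp add: c(3)[symmetric])
        then have "E (\<lambda>i. c l i + c (f n - l) i) \<in> K" using f(1) by simp
        from in_J[OF _ this] show ?thesis using c(1) by (simp add: d_def add_A)
      qed
      have "(\<lambda>n. C * norm (f n - l)) \<longlonglongrightarrow> C * 0"
        using f(2) by (intro tendsto_intros tendsto_norm_zero LIM_zero)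
      then have "(\<lambda>n. C * norm (f n - l)) \<longlonglongrightarrow> 0" by simp
      then have "d \<longlonglongrightarrow> 0"
        by (rule Lim_null_comparison[rotated]) (auto simp: d_def intro!: always_eventually c(2)[OF j])
      then have "(\<lambda>n. c l j + d n) \<longlonglongrightarrow> c l j + 0" by (intro tendsto_intros)
      then have "c l j \<in> J" using closed_sequentially[OF closed_J in_J'] by simp
      then have "c l \<in> F" using c(1) by (auto simp: F_def)
      then show "l \<in> K" using c(3)[of l] unfolding K_def by blast
    qed
  qed
  then have TK: "blinfun_apply T u \<in> K" if "u \<in> K" for u
    using T that by (auto simp: algLat_def)
  obtain a where a: "\<forall>i\<in>{1..p}. a i \<in> A" "z = E a"
    unfolding E_def using decomposition_ex by blast
  \<comment> \<open>Codimension one lets a scalar be subtracted from the \<open>j\<close>-th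
    coefficient to reach \<open>J\<close>. This changes \<open>z\<close> by a multiple of
    \<open>x j\<close>, which \<open>T\<close> annihilates, so \<open>T z\<close> is the image of a
    vector of \<open>K\<close>.\<close>
  obtain c where c: "a j - c *\<^sub>C id_blinfun \<in> J" using J_codim_1[of "a j"] a j by blast
  define a' where "a' = a(j := a j - c *\<^sub>C id_blinfun)"
  have "E a' = (\<Sum>i=1..p. blinfun_apply (a i) (x i) - (if i = j then c *\<^sub>C x j else 0))"
    unfolding E_def a'_def
    by (intro sum.cong) (auto simp: blinfun.diff_left scaleC_blinfun.rep_eq)
  also have "\<dots> = z - c *\<^sub>C x j" using j by (simp add: sum_subtractf a(2) E_def)
  finally have "z = E a' + c *\<^sub>C x j" by simp
  moreover have "blinfun_apply T (c *\<^sub>C x j) = c *\<^sub>C blinfun_apply T (x j)"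
    using T by (auto simp: algLat_def bounded_ops_def)
  then have "blinfun_apply T (c *\<^sub>C x j) = 0"
    using T0[OF j] linear_0[OF bounded_linear.linear[OF bounded_linear_scaleC]] by simp
  ultimately have "blinfun_apply T z = blinfun_apply T (E a')" by (simp add: blinfun.add_right)
  moreover have "a' \<in> F" using a c J_sub by (auto simp: F_def a'_def)
  ultimately have "E b \<in> K" using TK b(2) by (auto simp: E_def K_def)
  then show ?thesis using in_J[of b] b(1) by (simp add: J_def)
qed

end

theorem theorem4:
  fixes A :: "('a :: complex_banach \<Rightarrow>\<^sub>L 'a) set" and p :: nat and x :: "nat \<Rightarrow> 'a"
  assumes "abelian_unital_subalgebra A"
    and "closedin strong_operator_topology A"
    and "realizes_ssm A p x"
  shows "\<forall>T\<in>algLat A. \<exists>a\<^sub>0\<in>A. \<forall>z.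
    blinfun_apply (T - a\<^sub>0) z \<in> ssm_map p x ` (\<Pi>\<^sub>E j\<in>{1..p}. radical (quot_ring A (x j)))"
proof
  interpret ssm_algebra A p x by unfold_locales (use assms in auto)
  fix T assume T: "T \<in> algLat A"
  obtain a0 where a0: "a0 \<in> A" "\<And>j. j \<in> {1..p} \<Longrightarrow> blinfun_apply a0 (x j) = blinfun_apply T (x j)"
    using interpolating_element_ex[OF T] by blast
  \<comment> \<open>Each member of \<open>Lat A\<close> is invariant under both \<open>T\<close> and
    \<open>a0\<close>, so the difference qualifies and vanishes on all \<open>x j\<close>.\<close>
  have T': "T - a0 \<in> algLat A"
    unfolding algLat_def mem_Collect_eq
  proof (intro conjI ballI)
    show "T - a0 \<in> bounded_ops"
      using T a0(1) by (simp add: algLat_def bounded_ops_def blinfun.diff_left apply_scaleC scaleC_diff_right)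
    show "blinfun_apply (T - a0) ` K \<subseteq> K" if "K \<in> Lat A" for K
      using T a0(1) that csubspace_diff[of K]
      by (auto simp: algLat_def Lat_def blinfun.diff_left image_subset_iff)
  qed
  have "blinfun_apply (T - a0) z \<in> ssm_map p x ` (\<Pi>\<^sub>E j\<in>{1..p}. radical (quot_ring A (x j)))" for z
  proof -
    \<comment> \<open>Any coefficients will do: the \<open>j\<close>-th coset lies in every maximal
      ideal of its quotient, hence in the radical.\<close>
    obtain b where b: "\<forall>i\<in>{1..p}. b i \<in> A"
      "blinfun_apply (T - a0) z = (\<Sum>i=1..p. blinfun_apply (b i) (x i))"
      using decomposition_ex by blast
    show ?thesis
    proof (rule image_eqI)
      show "blinfun_apply (T - a0) z = ssm_map p x (\<lambda>j\<in>{1..p}. quot_map A (x j) (b j))"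
        using b by (subst ssm_map_quot_map[OF alg]) auto
      have "quot_map A (x j) (b j) \<in> radical (quot_ring A (x j))" if j: "j \<in> {1..p}" for j
        using component_in_maximal_ideal[OF T' _ j _ _ b(2)] a0(2) b(1) j
        by (auto simp: radical_def carrier_quot_ring blinfun.diff_left)
      then show "(\<lambda>j\<in>{1..p}. quot_map A (x j) (b j)) \<in> (\<Pi>\<^sub>E j\<in>{1..p}. radical (quot_ring A (x j)))"
        by auto
    qed
  qed
  then show "\<exists>a\<^sub>0\<in>A. \<forall>z. blinfun_apply (T - a\<^sub>0) z \<in>
      ssm_map p x ` (\<Pi>\<^sub>E j\<in>{1..p}. radical (quot_ring A (x j)))"
    using a0(1) by blast
qed

end
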